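(* There exist a pair of plane spanning trees $T_I,T_F$ of a set of $22$ points in convex position in the plane, and a pair of plane spanning trees $T'_I,T'_F$ of a set of $32$ points in convex position in the plane, such that any shortest flip sequence from $T_I$ to $T_F$ flips the same edge $3$ times (i.e. some edge of $T_I$ has trace of length $3$), and any shortest flip sequence from $T'_I$ to $T'_F$ flips the same edge $4$ times (i.e. some edge of $T'_I$ has trace of length $4$).
   Context: Let $P\subset\mathbb{R}^2$ be a finite set of points in convex position. Edges are straight-line segments $uv$ between distinct points $u,v\in P$. Two edges cross if their segments meet in a point other than a common endpoint. A plane spanning tree of $P$ ($|P|=n$) is a set of $n-1$ pairwise non-crossing edges forming a tree on the vertex set $P$. A flip $e\to f$ in a plane spanning tree $T$ removes an edge $e\in T$ and adds an edge $f\notin T$ such that $T-e+f$ is again a plane spanning tree of $P$ (the edges $e$ and $f$ may cross). A flip sequence from $T_I$ to $T_F$ is a sequence of plane spanning trees $T_I=T_0,T_1,\dots,T_k=T_F$ in which consecutive trees differ by a single flip; its length is $k$, and it is shortest if $k$ is minimum among all flip sequences from $T_I$ to $T_F$. The trace of an edge $e\in T_0$ in a flip sequence $T_0,\dots,T_k$ is the tuple of successive positions to which $e$ is flipped, defined recursively: it is $(e)$ if $k=0$; it equals the trace of $e$ in $T_1,\dots,T_k$ if $e\in T_0\cap T_1$; and it is $(e)$ followed by the trace of $f$ in $T_1,\dots,T_k$ if the first flip is $e\to f$. The length of a trace is its number of entries minus one, i.e. its number of flips. *)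

theory Defs
  imports "HOL-Analysis.Analysis"
begin

type_synonym point = "real ^ 2"

text \<open>
  An edge is its set of two endpoints; the corresponding segment is the convex hull of that set.
\<close>
type_synonym edge = "point set"

text \<open>
  No point lies in the convex hull of the others, so in particular no three points are collinear.
\<close>
definition convex_position :: "point set \<Rightarrow> bool" where
  "convex_position P \<longleftrightarrow> finite P \<and> (\<forall>p\<in>P. p \<notin> convex hull (P - {p}))"

definition edges_on :: "point set \<Rightarrow> edge set" where
  "edges_on P = {{u, v} | u v. u \<in> P \<and> v \<in> P \<and> u \<noteq> v}"

text \<open>
  For distinct edges, the set \<open>e \<inter> f\<close> consists of their common endpoint, if there is one.
\<close>
definition crosses :: "edge \<Rightarrow> edge \<Rightarrow> bool" where
  "crosses e f \<longleftrightarrow> e \<noteq> f \<and> (\<exists>x. x \<in> convex hull e \<and> x \<in> convex hull f \<and> x \<notin> e \<inter> f)"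

definition connected_on :: "'a set \<Rightarrow> 'a set set \<Rightarrow> bool" where
  "connected_on V E \<longleftrightarrow> (\<forall>u\<in>V. \<forall>v\<in>V. (\<lambda>x y. {x, y} \<in> E)\<^sup>*\<^sup>* u v)"

definition cycle_in :: "'a set set \<Rightarrow> 'a list \<Rightarrow> bool" where
  "cycle_in E c \<longleftrightarrow> distinct c \<and> length c \<ge> 3 \<and>
     successively (\<lambda>x y. {x, y} \<in> E) c \<and> {last c, hd c} \<in> E"

definition plane_spanning_tree :: "point set \<Rightarrow> edge set \<Rightarrow> bool" where
  "plane_spanning_tree P T \<longleftrightarrow>
     T \<subseteq> edges_on P \<and> card T + 1 = card P \<and> pairwise (\<lambda>e f. \<not> crosses e f) T \<and>
     connected_on P T \<and> (\<nexists>c. cycle_in T c)"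

definition flip :: "point set \<Rightarrow> edge set \<Rightarrow> edge set \<Rightarrow> bool" where
  "flip P T T' \<longleftrightarrow> plane_spanning_tree P T \<and> plane_spanning_tree P T' \<and>
     (\<exists>e f. e \<in> T \<and> f \<notin> T \<and> T' = insert f (T - {e}))"

definition flip_sequence :: "point set \<Rightarrow> edge set \<Rightarrow> edge set \<Rightarrow> edge set list \<Rightarrow> bool" where
  "flip_sequence P T\<^sub>I T\<^sub>F Ts \<longleftrightarrow>
     Ts \<noteq> [] \<and> hd Ts = T\<^sub>I \<and> last Ts = T\<^sub>F \<and>
     (\<forall>T\<in>set Ts. plane_spanning_tree P T) \<and> successively (flip P) Ts"

text \<open>
  A flip sequence is the list of its trees, so its length is the number of flips,
  one less than the length of the list.
\<close>
definition flip_count :: "edge set list \<Rightarrow> nat" where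
  "flip_count Ts = length Ts - 1"

definition shortest_flip_sequence ::
    "point set \<Rightarrow> edge set \<Rightarrow> edge set \<Rightarrow> edge set list \<Rightarrow> bool" where
  "shortest_flip_sequence P T\<^sub>I T\<^sub>F Ts \<longleftrightarrow>
     flip_sequence P T\<^sub>I T\<^sub>F Ts \<and>
     (\<forall>Ts'. flip_sequence P T\<^sub>I T\<^sub>F Ts' \<longrightarrow> flip_count Ts \<le> flip_count Ts')"

text \<open>
  If \<open>T\<^sub>1\<close> arises from \<open>T\<^sub>0\<close> by a flip, then \<open>T\<^sub>1 - T\<^sub>0\<close> is the singleton of the added edge, and an
  edge of \<open>T\<^sub>0\<close> that is not in \<open>T\<^sub>1\<close> is the removed one. The trace is meaningful for edges of the
  first tree of a flip sequence only; the equation for the empty list is a dummy.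
\<close>
fun trace :: "edge \<Rightarrow> edge set list \<Rightarrow> edge list" where
  "trace e [] = [e]"
| "trace e [T\<^sub>0] = [e]"
| "trace e (T\<^sub>0 # T\<^sub>1 # Ts) =
     (if e \<in> T\<^sub>1 then trace e (T\<^sub>1 # Ts)
      else e # trace (the_elem (T\<^sub>1 - T\<^sub>0)) (T\<^sub>1 # Ts))"

definition trace_length :: "edge \<Rightarrow> edge set list \<Rightarrow> nat" where
  "trace_length e Ts = length (trace e Ts) - 1"

end

theory Submission
  imports Defs
begin

text \<open>
  Both examples belong to a family on \<open>10 * r + 2\<close> points. In circular order these are \<open>4 * r + 1\<close> left
  vertices, \<open>r\<close> apexes, \<open>4 * r + 1\<close> right vertices and \<open>r\<close> bases, grouped into \<open>r\<close> boxes. In the initial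
  tree the left vertices of a box are attached to its apex and the right ones to its base, in the
  final tree it is the other way round, and one further edge connects the top to the bottom. The
  short flip sequence moves this edge through the bridges, which join the apex of a box to its base;
  a box can be rearranged one direct flip at a time while the edge is at its bridge.

  The final tree has \<open>6 * r + 1\<close> edges that the initial tree has not, so at most \<open>7 * r + 1\<close> flips leave
  room for at most \<open>r\<close> edges outside the two trees. Contracting the arcs between the points of a box
  turns trees into connected noncrossing graphs on 12 points, and a flip into a step that adds at
  most one edge. A finite exploration shows that such a graph can pass from one tree to the other
  only with the help of the bridge, or of three outside edges, or of two outside edges, one of them
  disjoint from the contraction of the later boxes and the other one from that of the earlier boxes.
  Counting over all boxes leaves the \<open>r\<close> bridges as the only possible outside edges. They cross
  pairwise, and there is no tree in between that avoids them all, so each bridge is flipped to the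
  next one. The edge that is flipped to the first bridge therefore has a trace of length \<open>r + 1\<close>.
\<close>

section \<open>Points on a parabola\<close>

type_synonym chord = "nat \<times> nat"

definition chords :: "nat \<Rightarrow> chord set" where
  "chords n = {(i, j). i < j \<and> j < n}"

fun interleave :: "chord \<Rightarrow> chord \<Rightarrow> bool" where
  "interleave (i, j) (k, l) \<longleftrightarrow> i < k \<and> k < j \<and> j < l \<or> k < i \<and> i < l \<and> l < j"

definition pt :: "nat \<Rightarrow> point" where
  "pt i = vector [real i, (real i)\<^sup>2]"

definition seg :: "chord \<Rightarrow> edge" where
  "seg e = {pt (fst e), pt (snd e)}"

lemma pt_nth [simp]: "pt i $ 1 = real i" "pt i $ 2 = (real i)\<^sup>2"
  by (simp_all add: pt_def)

lemma pt_eq_iff [simp]: "pt i = pt j \<longleftrightarrow> i = j"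
  by (metis pt_nth(1) of_nat_eq_iff)

lemma inj_pt: "inj_on pt A"
  by (simp add: inj_on_def)

lemma finite_chords [simp]: "finite (chords n)"
proof -
  have "chords n \<subseteq> {..<n} \<times> {..<n}" by (auto simp: chords_def)
  then show ?thesis by (rule finite_subset) simp
qed

lemma seg_eq_iff: "e \<in> chords n \<Longrightarrow> f \<in> chords m \<Longrightarrow> seg e = seg f \<longleftrightarrow> e = f"
  by (cases e; cases f) (auto simp: seg_def chords_def doubleton_eq_iff)

lemma inj_seg: "G \<subseteq> chords n \<Longrightarrow> inj_on seg G"
  by (meson inj_onI seg_eq_iff subsetD)

text \<open>The tangent at \<open>i\<close>, moved up by 1, cuts point \<open>i\<close> off from the
  others: point \<open>j\<close> has height \<open>(j - i)^2\<close> over the tangent, which is 0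
  for \<open>j = i\<close> and at least 1 for every other integer.\<close>

lemma convex_position_pt: "convex_position (pt ` {..<n})"
proof -
  have "pt i \<notin> convex hull (pt ` {..<n} - {pt i})" for i
  proof
    let ?H = "{x :: point. 1 - (real i)\<^sup>2 \<le> vector [- 2 * real i, 1] \<bullet> x}"
    assume "pt i \<in> convex hull (pt ` {..<n} - {pt i})"
    moreover have "convex hull (pt ` {..<n} - {pt i}) \<subseteq> ?H"
    proof (rule hull_minimal)
      show "convex ?H" using convex_halfspace_ge by blast
      show "pt ` {..<n} - {pt i} \<subseteq> ?H"
      proof
        fix x assume "x \<in> pt ` {..<n} - {pt i}"
        then obtain j where j: "x = pt j" "j \<noteq> i" by auto
        have "\<bar>real j - real i\<bar> \<ge> 1" using j(2) by linarith
        then have "(real j - real i)\<^sup>2 \<ge> 1"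
          by (metis one_le_power power2_abs)
        then show "x \<in> ?H"
          by (simp add: j(1) inner_vec_def sum_2 power2_eq_square algebra_simps)
      qed
    qed
    ultimately show False
      by (auto simp: inner_vec_def sum_2 power2_eq_square)
  qed
  then show ?thesis by (auto simp: convex_position_def)
qed

text \<open>
  The function \<open>\<lambda>x. x $ 2 - (i + j) * x $ 1 + i * j\<close> vanishes on the line through the points
  \<open>i\<close> and \<open>j\<close> of the parabola and equals \<open>(t - i) * (t - j)\<close> at the point \<open>t\<close>.
\<close>

lemma convex_hull_seg:
  "x \<in> convex hull (seg (k, l)) \<longleftrightarrow>
   (\<exists>a b. 0 \<le> a \<and> 0 \<le> b \<and> a + b = 1 \<and> x = a *\<^sub>R pt k + b *\<^sub>R pt l)"
  by (auto simp: seg_def convex_hull_2)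

lemma vanishing_combination:
  fixes a b p q :: real
  assumes "0 \<le> a" "0 \<le> b" "a * p + b * q = 0" "0 \<le> p \<and> 0 \<le> q \<or> p \<le> 0 \<and> q \<le> 0"
  shows "(a = 0 \<or> p = 0) \<and> (b = 0 \<or> q = 0)"
proof -
  have "0 \<le> (a * p) * (b * q)"
    using assms by (auto intro: mult_nonneg_nonneg mult_nonneg_nonpos mult_nonpos_nonpos)
  then show ?thesis using assms(3)
    by (smt (verit) mult_eq_0_iff mult_neg_pos mult_pos_neg)
qed

text \<open>Without interleaving, the points \<open>k\<close> and \<open>l\<close> lie on the same
  closed side of the line through \<open>i\<close> and \<open>j\<close>. A common point of the
  segments can then only be an endpoint of the second one on that line, and the line meets the
  parabola in \<open>i\<close> and \<open>j\<close> only.\<close>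

lemma not_crosses_if_not_interleave:
  assumes "i < j" "k < l" "\<not> interleave (i, j) (k, l)"
  shows "\<not> crosses (seg (i, j)) (seg (k, l))"
proof
  assume "crosses (seg (i, j)) (seg (k, l))"
  then obtain x where ne: "seg (i, j) \<noteq> seg (k, l)" and x: "x \<in> convex hull (seg (i, j))"
      "x \<in> convex hull (seg (k, l))" "x \<notin> seg (i, j) \<inter> seg (k, l)"
    unfolding crosses_def by blast
  define g where "g y = y $ 2 - (real i + real j) * y $ 1 + real i * real j" for y :: point
  define h where "h t = (real t - real i) * (real t - real j)" for t
  have g_pt: "g (pt t) = h t" for t
    by (simp add: g_def h_def power2_eq_square algebra_simps)
  have g_comb: "g (a *\<^sub>R y + b *\<^sub>R z) = a * g y + b * g z" if "a + b = 1" for a b y z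
  proof -
    have "real i * real j = (a + b) * (real i * real j)" using that by simp
    then show ?thesis by (simp add: g_def algebra_simps)
  qed
  obtain a b where ab: "0 \<le> a" "0 \<le> b" "a + b = 1" "x = a *\<^sub>R pt i + b *\<^sub>R pt j"
    using x(1) convex_hull_seg by blast
  have "g x = 0" by (simp add: ab g_comb g_pt h_def)
  obtain c d where cd: "0 \<le> c" "0 \<le> d" "c + d = 1" "x = c *\<^sub>R pt k + d *\<^sub>R pt l"
    using x(2) convex_hull_seg by blast
  have eq: "c * h k + d * h l = 0"
    using \<open>g x = 0\<close> by (simp add: cd g_comb g_pt)
  have pos: "h t \<ge> 0" if "t \<le> i \<or> j \<le> t" for t
    using that \<open>i < j\<close> by (auto simp: h_def zero_le_mult_iff)
  have neg: "h t \<le> 0" if "i \<le> t" "t \<le> j" for t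
    using that by (auto simp: h_def mult_le_0_iff)
  have "k \<in> {i..j} \<and> l \<in> {i..j} \<or> (k \<le> i \<or> j \<le> k) \<and> (l \<le> i \<or> j \<le> l)"
    using assms by auto
  then have "(c = 0 \<or> h k = 0) \<and> (d = 0 \<or> h l = 0)"
    using vanishing_combination[OF cd(1,2) eq] pos neg by (meson atLeastAtMost_iff)
  then have "(c = 0 \<or> k \<in> {i, j}) \<and> (d = 0 \<or> l \<in> {i, j})"
    by (auto simp: h_def)
  moreover have "\<not> (k \<in> {i, j} \<and> l \<in> {i, j})"
    using ne assms(1,2) by (auto simp: seg_def)
  moreover have "\<not> (c = 0 \<and> d = 0)" using cd(3) by auto
  ultimately have "c = 0 \<and> l \<in> {i, j} \<or> d = 0 \<and> k \<in> {i, j}"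
    by blast
  then show False
    using cd x(3) by (auto simp: seg_def)
qed

lemma crosses_if_interleave:
  assumes "i < k" "k < j" "j < l"
  shows "crosses (seg (i, j)) (seg (k, l))"
proof -
  \<comment> \<open>The lines are \<open>y = (i + j) x - i j\<close> and
    \<open>y = (k + l) x - k l\<close>. They meet at abscissa \<open>s\<close>, and \<open>D\<close>
    is the difference of their slopes. Interleaving puts \<open>s\<close> strictly between
    \<open>k\<close> and \<open>j\<close>, hence inside both segments.\<close>
  define D where "D = (real k + real l) - (real i + real j)"
  have D: "D > 0" using assms by (simp add: D_def)
  define s where "s = (real k * real l - real i * real j) / D"
  define a where "a = (s - real i) / (real j - real i)"
  define c where "c = (s - real k) / (real l - real k)"
  have sD: "s * D = real k * real l - real i * real j" using D by (simp add: s_def)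
  have "(s - real k) * D = (real k - real i) * (real j - real k)"
    unfolding left_diff_distrib sD by (simp add: D_def algebra_simps)
  moreover have "0 < (real k - real i) * (real j - real k)" using assms by simp
  ultimately have "0 < (s - real k) * D" by simp
  then have sk: "s > real k" using D zero_less_mult_pos2[of "s - real k" D] by simp
  have "(real j - s) * D = (real j - real k) * (real l - real j)"
    unfolding left_diff_distrib sD by (simp add: D_def algebra_simps)
  moreover have "0 < (real j - real k) * (real l - real j)" using assms by simp
  ultimately have "0 < (real j - s) * D" by simp
  then have sj: "s < real j" using D zero_less_mult_pos2[of "real j - s" D] by simp
  have a: "0 \<le> a" "0 \<le> 1 - a" and c: "0 \<le> c" "0 \<le> 1 - c"
    using assms sk sj by (simp_all add: a_def c_def divide_le_eq)
  have aji: "a * (real j - real i) = s - real i" using assms by (simp add: a_def)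
  have clk: "c * (real l - real k) = s - real k" using assms by (simp add: c_def)
  let ?x = "(1 - a) *\<^sub>R pt i + a *\<^sub>R pt j"
  let ?y = "(1 - c) *\<^sub>R pt k + c *\<^sub>R pt l"
  have x1: "?x $ 1 = s" using aji by (simp add: algebra_simps)
  have y1: "?y $ 1 = s" using clk by (simp add: algebra_simps)
  have "?x $ 2 = (real i)\<^sup>2 + (a * (real j - real i)) * (real j + real i)"
    by (simp add: algebra_simps power2_eq_square)
  then have x2: "?x $ 2 = (real i + real j) * s - real i * real j"
    unfolding aji by (simp add: algebra_simps power2_eq_square)
  have "?y $ 2 = (real k)\<^sup>2 + (c * (real l - real k)) * (real l + real k)"
    by (simp add: algebra_simps power2_eq_square)
  then have y2: "?y $ 2 = (real k + real l) * s - real k * real l"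
    unfolding clk by (simp add: algebra_simps power2_eq_square)
  have "?x $ 2 = ?y $ 2" unfolding x2 y2 using sD by (simp add: D_def algebra_simps)
  then have eq: "?x = ?y" unfolding vec_eq_iff forall_2 x1 y1 by blast
  have "?x \<in> convex hull (seg (i, j))" unfolding convex_hull_seg
    by (rule exI[of _ "1 - a"], rule exI[of _ a]) (use a in simp)
  moreover have "?x \<in> convex hull (seg (k, l))" unfolding eq convex_hull_seg
    by (rule exI[of _ "1 - c"], rule exI[of _ c]) (use c in simp)
  moreover have "seg (i, j) \<inter> seg (k, l) = {}" using assms by (auto simp: seg_def)
  moreover have "seg (i, j) \<noteq> seg (k, l)" using assms by (auto simp: seg_def doubleton_eq_iff)
  ultimately show ?thesis unfolding crosses_def by blast
qed

lemma crosses_commute: "crosses e f \<longleftrightarrow> crosses f e"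
  by (auto simp: crosses_def)

lemma crosses_seg_iff:
  assumes "e \<in> chords n" "f \<in> chords n"
  shows "crosses (seg e) (seg f) \<longleftrightarrow> interleave e f"
proof -
  obtain i j k l where e: "e = (i, j)" and f: "f = (k, l)" by fastforce
  then have "i < j" "k < l" using assms by (auto simp: chords_def)
  moreover have "crosses (seg e) (seg f)" if "interleave e f"
    using that crosses_if_interleave[of i k j l] crosses_if_interleave[of k i l j]
    by (auto simp: e f crosses_commute[of "seg (k, l)"])
  ultimately show ?thesis
    using not_crosses_if_not_interleave[of i j k l] by (auto simp: e f)
qed

lemma interleave_commute: "interleave e f \<longleftrightarrow> interleave f e"
  by (cases e; cases f) auto

section \<open>Connectivity and contraction\<close>

text \<open>Connectivity is phrased by cuts instead of paths: the uncut sets are the unions of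
  components, and they can be pulled back along a contraction.\<close>

definition uncut :: "chord set \<Rightarrow> nat set \<Rightarrow> bool" where
  "uncut E S \<longleftrightarrow> (\<forall>(i, j)\<in>E. i \<in> S \<longleftrightarrow> j \<in> S)"

definition linked :: "nat set \<Rightarrow> chord set \<Rightarrow> bool" where
  "linked V E \<longleftrightarrow> (\<forall>S. uncut E S \<longrightarrow> V \<subseteq> S \<or> V \<inter> S = {})"

lemma uncut_antimono: "uncut E' S \<Longrightarrow> E \<subseteq> E' \<Longrightarrow> uncut E S"
  by (meson uncut_def subsetD)

lemma linked_mono: "linked V E \<Longrightarrow> E \<subseteq> E' \<Longrightarrow> linked V E'"
  by (meson linked_def uncut_antimono)

definition redirect :: "nat \<Rightarrow> nat \<Rightarrow> chord \<Rightarrow> chord" where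
  "redirect w u e = (case e of (a, b) \<Rightarrow> (if a = w then u else a, if b = w then u else b))"

text \<open>Contracts the edges one by one and counts those that are not loops when their turn
  comes. This is an executable form of the number of vertices minus the number of
  components.\<close>

fun merges :: "chord list \<Rightarrow> nat" where
  "merges [] = 0"
| "merges ((u, w) # es) = (if u = w then merges es else Suc (merges (map (redirect w u) es)))"

text \<open>Contracting an edge between distinct vertices preserves connectedness in both directions
  and removes one vertex.\<close>

lemma linked_iff_merges:
  assumes "finite V" "V \<noteq> {}" "set es \<subseteq> V \<times> V"
  shows "linked V (set es) \<longleftrightarrow> Suc (merges es) = card V"
  using assms
proof (induction es arbitrary: V rule: merges.induct)
  case 1
  have "linked V {} \<longleftrightarrow> (\<exists>v. V = {v})"
  proof
    assume l: "linked V {}"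
    obtain v where "v \<in> V" using 1 by blast
    then show "\<exists>v. V = {v}" using l[unfolded linked_def, rule_format, of "{v}"] by (auto simp: uncut_def)
  qed (auto simp: linked_def)
  also have "\<dots> \<longleftrightarrow> card V = Suc 0" by (simp add: card_1_singleton_iff)
  finally show ?case by auto
next
  case (2 u w es)
  show ?case
  proof (cases "u = w")
    case True
    then have "linked V (set ((u, w) # es)) \<longleftrightarrow> linked V (set es)"
      by (auto simp: linked_def uncut_def)
    then show ?thesis using 2(1)[OF True] 2(3-) True by auto
  next
    case False
    let ?V = "V - {w}" and ?es = "map (redirect w u) es"
    have uw: "u \<in> ?V" "w \<in> V" using 2(5) False by auto
    have "set ?es \<subseteq> ?V \<times> ?V" using 2(5) uw by (auto simp: redirect_def split: if_splits)
    then have IH: "linked ?V (set ?es) \<longleftrightarrow> Suc (merges ?es) = card ?V"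
      using 2(2)[OF False, of ?V] 2(3) uw by blast
    have "linked V (set ((u, w) # es)) \<longleftrightarrow> linked ?V (set ?es)"
    proof
      assume l: "linked V (set ((u, w) # es))"
      show "linked ?V (set ?es)"
        unfolding linked_def
      proof (intro allI impI)
        fix S assume S: "uncut (set ?es) S"
        \<comment> \<open>A cut of the contracted graph is lifted by placing \<open>w\<close> on the
          side of \<open>u\<close>.\<close>
        let ?S = "if u \<in> S then insert w S else S - {w}"
        have mem: "x \<in> ?S \<longleftrightarrow> (if x = w then u else x) \<in> S" for x
          using False by auto
        have "(a \<in> ?S) = (b \<in> ?S)" if "(a, b) \<in> set es" for a b
        proof -
          have "redirect w u (a, b) \<in> set ?es" using that by simp
          then show ?thesis using S unfolding uncut_def mem redirect_def by auto
        qed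
        moreover have "(u \<in> ?S) = (w \<in> ?S)" using False by simp
        ultimately have "uncut (set ((u, w) # es)) ?S"
          unfolding uncut_def set_simps(2) ball_simps by fast
        then have "V \<subseteq> ?S \<or> V \<inter> ?S = {}" using l unfolding linked_def by blast
        then show "?V \<subseteq> S \<or> ?V \<inter> S = {}" by (auto split: if_splits)
      qed
    next
      assume l: "linked ?V (set ?es)"
      show "linked V (set ((u, w) # es))"
        unfolding linked_def
      proof (intro allI impI)
        fix S assume S: "uncut (set ((u, w) # es)) S"
        then have "u \<in> S \<longleftrightarrow> w \<in> S" by (simp add: uncut_def)
        then have mem: "(if x = w then u else x) \<in> S \<longleftrightarrow> x \<in> S" for x by auto
        have "uncut (set ?es) S"
          using S by (auto simp: uncut_def redirect_def mem simp del: if_split)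
        then have "?V \<subseteq> S \<or> ?V \<inter> S = {}" using l unfolding linked_def by blast
        with \<open>u \<in> S \<longleftrightarrow> w \<in> S\<close> uw show "V \<subseteq> S \<or> V \<inter> S = {}" by blast
      qed
    qed
    moreover have "card V = Suc (card ?V)"
      using 2(3) uw by (metis card_Suc_Diff1)
    ultimately show ?thesis using IH False by simp
  qed
qed

text \<open>A vertex set is grown from a single vertex: as long as it is not everything,
  connectedness provides an edge leaving it, so each new vertex comes with a new edge.\<close>

lemma card_le_if_linked:
  assumes "linked V E" "finite V" "finite E" "E \<subseteq> V \<times> V"
  shows "card V \<le> Suc (card E)"
proof (cases "V = {}")
  case False
  then obtain v where v: "v \<in> V" by blast
  have "\<exists>S\<subseteq>V. card S = Suc k \<and> k \<le> card (E \<inter> S \<times> S)" if "k < card V" for k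
    using that
  proof (induction k)
    case 0
    show ?case using v by (intro exI[of _ "{v}"]) auto
  next
    case (Suc k)
    then obtain S where S: "S \<subseteq> V" "card S = Suc k" "k \<le> card (E \<inter> S \<times> S)"
      by auto
    have "S \<noteq> {}" using S(2) by auto
    moreover have "\<not> V \<subseteq> S" using Suc.prems S(1,2) by auto
    ultimately have "\<not> uncut E S" using assms(1) S(1) unfolding linked_def by blast
    then obtain i j where ij: "(i, j) \<in> E" "(i \<in> S) \<noteq> (j \<in> S)" by (auto simp: uncut_def)
    let ?S = "insert i (insert j S)"
    have "?S \<subseteq> V" using S(1) ij(1) assms(4) by auto
    moreover have "card ?S = Suc (Suc k)"
    proof -
      have "?S = insert j S \<and> j \<notin> S \<or> ?S = insert i S \<and> i \<notin> S" using ij(2) by blast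
      then show ?thesis using S(2) finite_subset[OF S(1) assms(2)] by auto
    qed
    moreover have "Suc k \<le> card (E \<inter> ?S \<times> ?S)"
    proof -
      have "insert (i, j) (E \<inter> S \<times> S) \<subseteq> E \<inter> ?S \<times> ?S" using ij(1) by auto
      then have "card (insert (i, j) (E \<inter> S \<times> S)) \<le> card (E \<inter> ?S \<times> ?S)"
        using assms(3) by (intro card_mono) auto
      moreover have "(i, j) \<notin> E \<inter> S \<times> S" using ij(2) by auto
      ultimately show ?thesis using S(3) assms(3) by auto
    qed
    ultimately show ?case by blast
  qed
  from this[of "card V - 1"] obtain S where "card V - 1 \<le> card (E \<inter> S \<times> S)"
    using False assms(2) by (metis card_gt_0_iff diff_less zero_less_one)
  also have "\<dots> \<le> card E" using assms(3) by (intro card_mono) auto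
  finally show ?thesis by simp
qed simp

section \<open>Plane spanning trees\<close>

text \<open>Acyclicity follows from connectedness and the number of chords, see
  \<open>no_cycle_in_tree\<close>.\<close>

definition tree :: "nat \<Rightarrow> chord set \<Rightarrow> bool" where
  "tree n G \<longleftrightarrow> G \<subseteq> chords n \<and> card G + 1 = n \<and> pairwise (\<lambda>e f. \<not> interleave e f) G \<and>
     linked {..<n} G"

lemma seg_adjacent_iff:
  assumes "G \<subseteq> chords n"
  shows "{pt i, pt j} \<in> seg ` G \<longleftrightarrow> (i, j) \<in> G \<or> (j, i) \<in> G"
  by (force simp: seg_def doubleton_eq_iff image_iff)

lemma uncut_adjacent:
  assumes "uncut G S" "{pt i, pt j} \<in> seg ` G"
  shows "i \<in> S \<longleftrightarrow> j \<in> S"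
  using assms by (force simp: seg_def doubleton_eq_iff uncut_def)

lemma connected_on_seg_iff:
  assumes G: "G \<subseteq> chords n"
  shows "connected_on (pt ` {..<n}) (seg ` G) \<longleftrightarrow> linked {..<n} G"
proof
  assume con: "connected_on (pt ` {..<n}) (seg ` G)"
  show "linked {..<n} G"
    unfolding linked_def
  proof (intro allI impI, rule ccontr)
    fix S assume S: "uncut G S" "\<not> ({..<n} \<subseteq> S \<or> {..<n} \<inter> S = {})"
    then obtain u v where uv: "u < n" "u \<in> S" "v < n" "v \<notin> S" by blast
    have "(\<lambda>x y. {x, y} \<in> seg ` G)\<^sup>*\<^sup>* (pt u) (pt v)"
      using con uv unfolding connected_on_def by blast
    then have "\<exists>w\<in>S. pt v = pt w"
    proof (induction rule: rtranclp_induct)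
      case (step y z)
      then obtain w where w: "w \<in> S" "y = pt w" by blast
      moreover obtain w' where "z = pt w'"
        using step.hyps(2) by (force simp: seg_def doubleton_eq_iff)
      ultimately show ?case using uncut_adjacent[OF S(1)] step.hyps(2) by blast
    qed (use uv in blast)
    then show False using uv by simp
  qed
next
  assume l: "linked {..<n} G"
  show "connected_on (pt ` {..<n}) (seg ` G)"
    unfolding connected_on_def
  proof (intro ballI)
    fix x y assume "x \<in> pt ` {..<n}" "y \<in> pt ` {..<n}"
    then obtain u v where uv: "u < n" "x = pt u" "v < n" "y = pt v" by auto
    let ?R = "(\<lambda>x y. {x, y} \<in> seg ` G)\<^sup>*\<^sup>*"
    let ?S = "{w. ?R x (pt w)}"
    have "uncut G ?S"
    proof (unfold uncut_def, clarify)
      fix i j assume "(i, j) \<in> G"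
      then have "{pt i, pt j} \<in> seg ` G" "{pt j, pt i} \<in> seg ` G"
        using seg_adjacent_iff[OF G] by blast+
      then show "(i \<in> ?S) = (j \<in> ?S)"
        by (auto intro: rtranclp.rtrancl_into_rtrancl)
    qed
    moreover have "u \<in> {..<n} \<inter> ?S" using uv by simp
    ultimately have "{..<n} \<subseteq> ?S" using l unfolding linked_def by blast
    then show "?R x y" using uv by auto
  qed
qed

text \<open>Without the closing edge of a cycle the graph would stay connected, because the rest of
  the cycle still joins its ends; but \<open>n - 2\<close> edges cannot connect \<open>n\<close>
  vertices.\<close>

lemma no_cycle_in_tree:
  assumes "tree n G"
  shows "\<not> cycle_in (seg ` G) c"
proof
  assume c: "cycle_in (seg ` G) c"
  have G: "G \<subseteq> chords n" "linked {..<n} G" "card G + 1 = n"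
    using assms by (auto simp: tree_def)
  have len: "length c \<ge> 3" and dist: "distinct c" using c by (auto simp: cycle_in_def)
  obtain g where g: "g \<in> G" "seg g = {last c, hd c}" using c by (auto simp: cycle_in_def)
  have "linked {..<n} (G - {g})"
    unfolding linked_def
  proof (intro allI impI)
    fix S assume S: "uncut (G - {g}) S"
    have step: "c ! Suc i \<in> pt ` S \<longleftrightarrow> c ! i \<in> pt ` S" if i: "Suc i < length c" for i
    proof -
      have "{c ! i, c ! Suc i} \<in> seg ` G"
        using c i unfolding cycle_in_def successively_conv_nth by blast
      then obtain h where h: "h \<in> G" "seg h = {c ! i, c ! Suc i}" by auto
      have idx: "c ! i = c ! 0 \<longleftrightarrow> i = 0" "c ! Suc i = c ! 0 \<longleftrightarrow> Suc i = 0"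
        "c ! Suc i = c ! (length c - 1) \<longleftrightarrow> Suc i = length c - 1"
        using i len nth_eq_iff_index_eq[OF dist, of i 0] nth_eq_iff_index_eq[OF dist, of "Suc i" 0]
          nth_eq_iff_index_eq[OF dist, of "Suc i" "length c - 1"] by linarith+
      \<comment> \<open>As the cycle has at least three vertices, no consecutive pair of the list is
        the closing pair.\<close>
      have "{c ! i, c ! Suc i} \<noteq> {c ! (length c - 1), c ! 0}"
        unfolding doubleton_eq_iff idx using len by arith
      moreover have "c \<noteq> []" using len by auto
      ultimately have "h \<noteq> g" using h(2) g(2) by (auto simp: last_conv_nth hd_conv_nth)
      then have "h \<in> G - {g}" using h by blast
      moreover obtain k l where kl: "c ! i = pt k" "c ! Suc i = pt l"
        using h(2) unfolding seg_def by (metis doubleton_eq_iff)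
      ultimately have "k \<in> S \<longleftrightarrow> l \<in> S" using uncut_adjacent[OF S, of k l] h(2) by force
      then show ?thesis by (auto simp: kl)
    qed
    have "i < length c \<Longrightarrow> c ! i \<in> pt ` S \<longleftrightarrow> c ! 0 \<in> pt ` S" for i
      by (induction i) (use step Suc_lessD in blast)+
    from this[of "length c - 1"] have ends: "last c \<in> pt ` S \<longleftrightarrow> hd c \<in> pt ` S"
      using len by (simp add: last_conv_nth hd_conv_nth flip: length_greater_0_conv)
    have mem: "x \<in> S \<longleftrightarrow> pt x \<in> pt ` S" for x by auto
    have "fst g \<in> S \<longleftrightarrow> snd g \<in> S"
      using ends g(2) unfolding seg_def doubleton_eq_iff mem by metis
    then have "uncut G S" using S by (cases g) (auto simp: uncut_def)
    then show "{..<n} \<subseteq> S \<or> {..<n} \<inter> S = {}" using G(2) unfolding linked_def by blast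
  qed
  moreover have "G - {g} \<subseteq> {..<n} \<times> {..<n}" using G(1) by (auto simp: chords_def)
  moreover have "finite G" using G(1) finite_subset finite_chords by blast
  ultimately have "card {..<n} \<le> Suc (card (G - {g}))"
    by (intro card_le_if_linked) auto
  moreover have "card G = Suc (card (G - {g}))"
    using g(1) \<open>finite G\<close> by (simp only: card_Suc_Diff1)
  ultimately show False using G(3) by simp
qed

lemma plane_spanning_tree_seg_iff:
  assumes G: "G \<subseteq> chords n"
  shows "plane_spanning_tree (pt ` {..<n}) (seg ` G) \<longleftrightarrow> tree n G"
proof -
  have "seg ` G \<subseteq> edges_on (pt ` {..<n})"
    using G by (fastforce simp: seg_def edges_on_def chords_def)
  moreover have "card (seg ` G) = card G" using inj_seg[OF G] by (rule card_image)
  moreover have "card (pt ` {..<n}) = n" using inj_pt by (simp add: card_image)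
  moreover have "pairwise (\<lambda>e f. \<not> crosses e f) (seg ` G) \<longleftrightarrow> pairwise (\<lambda>e f. \<not> interleave e f) G"
  proof -
    have *: "(seg e \<noteq> seg f \<longrightarrow> \<not> crosses (seg e) (seg f)) \<longleftrightarrow> \<not> interleave e f"
      if "e \<in> G" "f \<in> G" "e \<noteq> f" for e f
    proof -
      have "e \<in> chords n" "f \<in> chords n" using that G by auto
      then show ?thesis using crosses_seg_iff seg_eq_iff that(3) by simp
    qed
    show ?thesis
      unfolding pairwise_image unfolding pairwise_def
      by (rule ball_cong[OF refl], rule ball_cong[OF refl], rule imp_cong[OF refl], rule *)
  qed
  ultimately show ?thesis
    unfolding plane_spanning_tree_def connected_on_seg_iff[OF G]
    using no_cycle_in_tree[of n G] G by (auto simp: tree_def)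
qed

section \<open>Translation of edge sets to chord sets\<close>

definition chords_of :: "nat \<Rightarrow> edge set \<Rightarrow> chord set" where
  "chords_of n T = {e \<in> chords n. seg e \<in> T}"

lemma seg_chords_of:
  assumes "T \<subseteq> edges_on (pt ` {..<n})"
  shows "seg ` chords_of n T = T"
proof
  show "T \<subseteq> seg ` chords_of n T"
  proof
    fix e assume e: "e \<in> T"
    then have "e \<in> edges_on (pt ` {..<n})" using assms by blast
    then obtain u v where uv: "e = {u, v}" "u \<in> pt ` {..<n}" "v \<in> pt ` {..<n}" "u \<noteq> v"
      unfolding edges_on_def by blast
    then obtain i j where ij: "e = {pt i, pt j}" "i < n" "j < n" "i \<noteq> j"
      by blast
    let ?c = "(min i j, max i j)"
    have c: "seg ?c = e" by (auto simp: seg_def ij(1) min_def max_def)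
    have "?c \<in> chords n" using ij by (auto simp: chords_def)
    then have "?c \<in> chords_of n T" using e c by (simp add: chords_of_def)
    then show "e \<in> seg ` chords_of n T" using c by blast
  qed
qed (auto simp: chords_of_def)

lemma chords_of_seg:
  assumes "G \<subseteq> chords n"
  shows "chords_of n (seg ` G) = G"
proof
  show "chords_of n (seg ` G) \<subseteq> G"
  proof
    fix e assume "e \<in> chords_of n (seg ` G)"
    then obtain f where "e \<in> chords n" "f \<in> G" "seg e = seg f"
      unfolding chords_of_def by blast
    then show "e \<in> G" using assms seg_eq_iff by blast
  qed
  show "G \<subseteq> chords_of n (seg ` G)" using assms by (auto simp: chords_of_def)
qed

lemma tree_chords_of:
  assumes "plane_spanning_tree (pt ` {..<n}) T"
  shows "tree n (chords_of n T)" "seg ` chords_of n T = T"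
proof -
  show eq: "seg ` chords_of n T = T"
    using assms by (intro seg_chords_of) (simp add: plane_spanning_tree_def)
  have "chords_of n T \<subseteq> chords n" by (auto simp: chords_of_def)
  then show "tree n (chords_of n T)"
    using plane_spanning_tree_seg_iff[of "chords_of n T" n] assms eq by simp
qed

section \<open>The two trees and their boxes\<close>

text \<open>
  The left vertices are \<open>0, \<dots>, 4 * r\<close> and the right ones \<open>5 * r + 1, \<dots>, 9 * r + 1\<close>; consecutive
  boxes share one vertex on each side. Boxes are counted from \<open>0\<close>, and the apexes and the bases
  appear on the circle in decreasing order of their boxes.
\<close>

definition apex :: "nat \<Rightarrow> nat \<Rightarrow> nat" where
  "apex r i = 5 * r - i"

definition base :: "nat \<Rightarrow> nat \<Rightarrow> nat" where
  "base r i = 10 * r + 1 - i"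

definition common_chords :: "nat \<Rightarrow> chord list" where
  "common_chords r = concat (map (\<lambda>i.
     [(4 * i, 4 * i + 1), (4 * i + 3, 4 * i + 4),
      (5 * r + 4 * i + 1, 5 * r + 4 * i + 2), (5 * r + 4 * i + 4, 5 * r + 4 * i + 5)]) [0..<r])"

text \<open>The order matters: the entries of \<open>old_box\<close> and \<open>new_box\<close> at
  the same position are exchanged by one flip in \<open>moves\<close>.\<close>

definition old_box :: "nat \<Rightarrow> nat \<Rightarrow> chord list" where
  "old_box r i =
     [(4 * i, apex r i), (4 * i + 2, apex r i), (4 * i + 3, apex r i),
      (5 * r + 4 * i + 1, base r i), (5 * r + 4 * i + 3, base r i),
      (5 * r + 4 * i + 4, base r i)]"

definition new_box :: "nat \<Rightarrow> nat \<Rightarrow> chord list" where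
  "new_box r i =
     [(4 * i + 1, base r i), (4 * i + 2, base r i), (4 * i + 4, base r i),
      (apex r i, 5 * r + 4 * i + 2), (apex r i, 5 * r + 4 * i + 3),
      (apex r i, 5 * r + 4 * i + 5)]"

definition old_chords :: "nat \<Rightarrow> chord list" where
  "old_chords r = (0, 5 * r + 1) # concat (map (old_box r) [0..<r])"

definition new_chords :: "nat \<Rightarrow> chord list" where
  "new_chords r = (4 * r, 9 * r + 1) # concat (map (new_box r) [0..<r])"

definition bridge :: "nat \<Rightarrow> nat \<Rightarrow> chord" where
  "bridge r i = (apex r i, base r i)"

definition initial :: "nat \<Rightarrow> chord list" where
  "initial r = common_chords r @ old_chords r"

definition final :: "nat \<Rightarrow> chord list" where
  "final r = common_chords r @ new_chords r"

text \<open>A weakly increasing step function. Truncated subtraction keeps it constant on the arcs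
  to be contracted; it climbs by 4 along the left and along the right vertices of the box, and by 2
  around the apex and around the base.\<close>

definition rank :: "nat \<Rightarrow> nat \<Rightarrow> nat \<Rightarrow> nat" where
  "rank r i v = min 4 (v - 4 * i) + min 2 (v - (5 * r - Suc i)) +
     min 4 (v - (5 * r + 4 * i + 1)) + min 2 (v - (10 * r - i))"

text \<open>
  The ranks \<open>0\<close> and \<open>12\<close> belong to the same arc, which is cut by the start of the numbering. Rank \<open>5\<close>
  is the apex and rank \<open>11\<close> the base of box \<open>i\<close>; earlier boxes are contracted to \<open>0\<close> and \<open>6\<close>, later ones
  to \<open>4\<close> and \<open>10\<close>. The result is the instance \<open>r = 1\<close>.
\<close>

definition proj :: "nat \<Rightarrow> nat \<Rightarrow> nat \<Rightarrow> nat" where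
  "proj r i v = (if rank r i v = 12 then 0 else rank r i v)"

definition collapse :: "nat \<Rightarrow> nat \<Rightarrow> chord \<Rightarrow> chord" where
  "collapse r i e = (min (proj r i (fst e)) (proj r i (snd e)), max (proj r i (fst e)) (proj r i (snd e)))"

definition loop :: "nat \<Rightarrow> nat \<Rightarrow> chord \<Rightarrow> bool" where
  "loop r i e \<longleftrightarrow> proj r i (fst e) = proj r i (snd e)"

definition quot :: "nat \<Rightarrow> nat \<Rightarrow> chord set \<Rightarrow> chord set" where
  "quot r i G = collapse r i ` {e \<in> G. \<not> loop r i e}"

section \<open>Properties of the contraction\<close>

lemma rank_mono: "v \<le> w \<Longrightarrow> rank r i v \<le> rank r i w"
  unfolding rank_def by (intro add_mono min.mono diff_le_mono order_refl)

lemma rank_le: "rank r i v \<le> 12"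
proof -
  have "rank r i v \<le> 4 + 2 + 4 + 2"
    unfolding rank_def by (intro add_mono min.cobounded1)
  then show ?thesis by simp
qed

lemma proj_less: "proj r i v < 12"
  using rank_le[of r i v] by (auto simp: proj_def)

lemma rank_cases:
  assumes "i < r" "v < 10 * r + 2"
  obtains (left) "v \<le> 4 * r" "rank r i v = min 4 (v - 4 * i)"
  | (top) "4 * r < v" "v + i < 5 * r" "rank r i v = 4"
  | (apex) "v + i = 5 * r" "rank r i v = 5"
  | (top') "5 * r < v + i" "v \<le> 5 * r" "rank r i v = 6"
  | (right) w where "v = 5 * r + 1 + w" "w \<le> 4 * r" "rank r i v = 6 + min 4 (w - 4 * i)"
  | (bottom) "9 * r + 1 < v" "v + i < 10 * r + 1" "rank r i v = 10"
  | (base) "v + i = 10 * r + 1" "rank r i v = 11"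
  | (bottom') "10 * r + 1 < v + i" "rank r i v = 12"
proof -
  consider "v \<le> 4 * r" | "4 * r < v" "v + i < 5 * r" | "v + i = 5 * r" | "5 * r < v + i" "v \<le> 5 * r"
    | "5 * r < v" "v \<le> 9 * r + 1" | "9 * r + 1 < v" "v + i < 10 * r + 1"
    | "v + i = 10 * r + 1" | "10 * r + 1 < v + i"
    by linarith
  then show thesis
  proof cases
    case 1
    then show thesis using left assms by (auto simp: rank_def)
  next
    case 2
    then show thesis using top assms by (auto simp: rank_def)
  next
    case 3
    then show thesis using apex assms by (auto simp: rank_def)
  next
    case 4
    then show thesis using top' assms by (auto simp: rank_def)
  next
    case 5
    then obtain w where w: "v = 5 * r + 1 + w" using less_imp_Suc_add by fastforce
    moreover from this have "rank r i v = 6 + min 4 (w - 4 * i)"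
      using 5 assms by (simp add: rank_def)
    ultimately show thesis using right[of w] 5 by simp
  next
    case 6
    then show thesis using bottom assms by (auto simp: rank_def)
  next
    case 7
    then show thesis using base assms by (auto simp: rank_def)
  next
    case 8
    then show thesis using bottom' assms by (auto simp: rank_def)
  qed
qed

lemma proj_surj:
  assumes "i < r" "w < 12"
  shows "\<exists>v<10 * r + 2. proj r i v = w"
proof -
  consider "w \<le> 4" | "w = 5" | "6 \<le> w \<and> w \<le> 10" | "w = 11" using assms(2) by linarith
  then show ?thesis
  proof cases
    case 1
    then show ?thesis using assms(1)
      by (intro exI[of _ "4 * i + w"]) (auto simp: proj_def rank_def)
  next
    case 2
    then show ?thesis using assms(1)
      by (intro exI[of _ "5 * r - i"]) (auto simp: proj_def rank_def)
  next
    case 3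
    then show ?thesis using assms(1)
      by (intro exI[of _ "5 * r + 4 * i + 1 + (w - 6)"]) (auto simp: proj_def rank_def)
  next
    case 4
    then show ?thesis using assms(1)
      by (intro exI[of _ "10 * r + 1 - i"]) (auto simp: proj_def rank_def)
  qed
qed

text \<open>What box \<open>i\<close> does not contract towards the later boxes belongs to itself or
  to earlier boxes, and box \<open>j\<close> contracts all of that.\<close>

lemma proj_later:
  assumes "i < j" "j < r" "v < 10 * r + 2" "proj r i v \<notin> {4, 10}"
  shows "proj r j v \<in> {0, 6}"
proof -
  have "i < r" using assms by simp
  from this assms(3) show ?thesis
    by (cases rule: rank_cases; use assms(2,3) in \<open>cases rule: rank_cases\<close>)
       (use assms(1,2,4) in \<open>auto simp: proj_def min_def split: if_splits\<close>)
qed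

lemma proj_earlier:
  assumes "j < i" "i < r" "v < 10 * r + 2" "proj r i v \<notin> {0, 6}"
  shows "proj r j v \<in> {4, 10}"
proof -
  have "j < r" using assms by simp
  from this assms(3) show ?thesis
    by (cases rule: rank_cases; use assms(2,3) in \<open>cases rule: rank_cases\<close>)
       (use assms(1,2,4) in \<open>auto simp: proj_def min_def split: if_splits\<close>)
qed

lemma proj_apex_iff:
  assumes "i < r" "v < 10 * r + 2"
  shows "proj r i v = 5 \<longleftrightarrow> v = apex r i"
  using assms by (cases rule: rank_cases) (use assms(1) in \<open>auto simp: proj_def apex_def\<close>)

lemma proj_base_iff:
  assumes "i < r" "v < 10 * r + 2"
  shows "proj r i v = 11 \<longleftrightarrow> v = base r i"
  using assms by (cases rule: rank_cases) (use assms(1) in \<open>auto simp: proj_def base_def\<close>)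

lemma collapse_in_chords: "\<not> loop r i e \<Longrightarrow> collapse r i e \<in> chords 12"
  using proj_less[of r i "fst e"] proj_less[of r i "snd e"]
  by (auto simp: collapse_def loop_def chords_def min_def max_def)

text \<open>Ranks are monotone, so strict inequalities between ranks lift to the vertices. The only
  irregularity is rank 12, renamed to 0: a chord ending there turns around, and two such chords
  share the vertex 0 and cannot interleave.\<close>

lemma interleave_collapse:
  assumes "i < r" "e \<in> chords n" "f \<in> chords n" "\<not> loop r i e" "\<not> loop r i f"
    "interleave (collapse r i e) (collapse r i f)"
  shows "interleave e f"
proof -
  obtain a b c d where e: "e = (a, b)" and f: "f = (c, d)" by fastforce
  have ab: "a < b" and cd: "c < d" using assms(2,3) by (auto simp: e f chords_def)
  let ?p = "rank r i"
  have less: "v < w" if "?p v < ?p w" for v w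
    using that rank_mono[of w v r i] by linarith
  have coll: "collapse r i (v, w) = (if ?p w = 12 then (0, ?p v) else (?p v, ?p w))"
    if "v < w" "\<not> loop r i (v, w)" for v w
    using rank_mono[of v w r i] that rank_le[of r i w]
    by (auto simp: collapse_def proj_def loop_def)
  have le: "?p b \<le> 12" "?p d \<le> 12" by (simp_all add: rank_le)
  have "interleave (if ?p b = 12 then (0, ?p a) else (?p a, ?p b))
     (if ?p d = 12 then (0, ?p c) else (?p c, ?p d))"
    using assms(6) unfolding e f coll[OF ab assms(4)[unfolded e]] coll[OF cd assms(5)[unfolded f]] .
  then consider "?p b \<noteq> 12" "?p d \<noteq> 12" "interleave (?p a, ?p b) (?p c, ?p d)"
    | "?p b = 12" "?p d \<noteq> 12" "interleave (0, ?p a) (?p c, ?p d)"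
    | "?p b \<noteq> 12" "?p d = 12" "interleave (?p a, ?p b) (0, ?p c)"
    by (auto split: if_splits)
  then show ?thesis
  proof cases
    case 1
    then show ?thesis unfolding e f using less by auto
  next
    case 2
    then have "?p c < ?p a" "?p a < ?p d" "?p d < ?p b" using le by auto
    then show ?thesis unfolding e f using less by auto
  next
    case 3
    then have "?p a < ?p c" "?p c < ?p b" "?p b < ?p d" using le by auto
    then show ?thesis unfolding e f using less by auto
  qed
qed

text \<open>The preimage under \<open>proj\<close> of an uncut set is uncut, since a contracted
  chord has both ends on the same side.\<close>

lemma linked_quot:
  assumes "i < r" "linked {..<10 * r + 2} G"
  shows "linked {..<12} (quot r i G)"
  unfolding linked_def
proof (intro allI impI)
  fix S assume S: "uncut (quot r i G) S"
  have "uncut G {v. proj r i v \<in> S}"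
  proof (unfold uncut_def, clarify)
    fix a b assume ab: "(a, b) \<in> G"
    show "(a \<in> {v. proj r i v \<in> S}) = (b \<in> {v. proj r i v \<in> S})"
    proof (cases "loop r i (a, b)")
      case False
      then have "collapse r i (a, b) \<in> quot r i G" using ab by (auto simp: quot_def)
      then show ?thesis using S by (auto simp: uncut_def collapse_def min_def max_def split: if_splits)
    qed (simp add: loop_def)
  qed
  then have "{..<10 * r + 2} \<subseteq> {v. proj r i v \<in> S} \<or> {..<10 * r + 2} \<inter> {v. proj r i v \<in> S} = {}"
    using assms(2) unfolding linked_def by blast
  then show "{..<12} \<subseteq> S \<or> {..<12} \<inter> S = {}"
    using proj_surj[OF assms(1)] by blast
qed

section \<open>Exploration of a single box\<close>

definition compatible :: "chord \<Rightarrow> chord list \<Rightarrow> chord list" where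
  "compatible e s = filter (\<lambda>g. \<not> interleave e g) s"

text \<open>Adding every chord that crosses nothing in the list only coarsens the
  over-approximation, and more graphs are then covered by a list seen before.\<close>

definition saturate :: "chord list \<Rightarrow> chord list \<Rightarrow> chord list" where
  "saturate W s = filter (\<lambda>e. e \<notin> set s \<and> (\<forall>g\<in>set s. \<not> interleave e g)) W @ s"

text \<open>Eleven merges mean connectedness on 12 points. A disconnected list contains no connected
  graph, so discarding it loses nothing.\<close>

definition successors :: "chord list \<Rightarrow> chord list \<Rightarrow> chord list list \<Rightarrow> chord list list" where
  "successors W s seen = map (saturate W)
     (filter (\<lambda>t. \<not> (\<exists>u\<in>set seen. \<forall>e\<in>set t. e \<in> set u) \<and> merges t = 11)
       (map (\<lambda>a. a # compatible a s) (filter (\<lambda>a. a \<notin> set s) W)))"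

text \<open>
  Every noncrossing connected graph that is reachable by adding chords of \<open>W\<close> and discarding
  chords is contained in one of the collected lists, which need not be noncrossing themselves.
  The first argument only bounds the number of rounds.
\<close>
fun explore :: "chord list \<Rightarrow> chord list \<Rightarrow> chord list \<Rightarrow> chord list list \<Rightarrow> chord list list \<Rightarrow> bool" where
  "explore [] W F todo old = (todo = [])"
| "explore (x # xs) W F [] old = True"
| "explore (x # xs) W F (s # todo) old =
     (\<not> (\<forall>e\<in>set F. e \<in> set s) \<and>
      explore xs W F (successors W s (s # todo @ old) @ todo) (s # old))"

definition trapped :: "chord list \<Rightarrow> chord list \<Rightarrow> chord list \<Rightarrow> bool" where
  "trapped A W F \<longleftrightarrow> explore (W @ W @ W) W F [saturate W A] []"

definition covers :: "chord list \<Rightarrow> chord list \<Rightarrow> chord list set \<Rightarrow> bool" where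
  "covers W s I \<longleftrightarrow> (\<forall>a\<in>set W. a \<in> set s \<or> merges (a # compatible a s) \<noteq> 11 \<or>
     (\<exists>u\<in>I. set (a # compatible a s) \<subseteq> set u))"

lemma covers_mono: "covers W s I \<Longrightarrow> (\<And>u. u \<in> I \<Longrightarrow> \<exists>v\<in>J. set u \<subseteq> set v) \<Longrightarrow> covers W s J"
  unfolding covers_def by (meson subset_trans)

text \<open>All moves out of the processed lists \<open>old\<close> lead into waiting or processed
  lists. A successful run ends with nothing waiting, so the processed lists form a family closed
  under moves in which none contains \<open>F\<close>.\<close>

lemma explore_invariant:
  assumes "explore xs W F todo old"
    "\<forall>s\<in>set old. \<not> set F \<subseteq> set s \<and> covers W s (set todo \<union> set old)"
    "set W \<subseteq> C" "\<forall>s\<in>set todo \<union> set old. set s \<subseteq> C"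
  shows "\<exists>I. set todo \<union> set old \<subseteq> I \<and>
    (\<forall>s\<in>I. set s \<subseteq> C \<and> \<not> set F \<subseteq> set s \<and> covers W s I)"
  using assms
proof (induction xs W F todo old rule: explore.induct)
  case (3 x xs W F s todo old)
  let ?new = "successors W s (s # todo @ old)"
  let ?J = "set (?new @ todo) \<union> set (s # old)"
  have sub: "set (s # todo) \<union> set old \<subseteq> ?J" by auto
  have "covers W s ?J"
    unfolding covers_def
  proof (intro ballI)
    fix a assume a: "a \<in> set W"
    let ?t = "a # compatible a s"
    show "a \<in> set s \<or> merges ?t \<noteq> 11 \<or> (\<exists>u\<in>?J. set ?t \<subseteq> set u)"
    proof (cases "a \<in> set s \<or> merges ?t \<noteq> 11 \<or> (\<exists>u\<in>set (s # todo @ old). \<forall>e\<in>set ?t. e \<in> set u)")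
      case True
      then show ?thesis using sub by (auto simp: subset_iff)
    next
      case False
      then have "saturate W ?t \<in> set ?new"
        using a unfolding successors_def set_map set_filter by blast
      moreover have "set ?t \<subseteq> set (saturate W ?t)" by (auto simp: saturate_def)
      ultimately show ?thesis by auto
    qed
  qed
  moreover have "covers W u ?J" if "u \<in> set old" for u
    by (rule covers_mono[of W u "set (s # todo) \<union> set old"]) (use 3(3) that sub in auto)
  ultimately have "\<forall>u\<in>set (s # old). \<not> set F \<subseteq> set u \<and> covers W u ?J"
    using 3(2,3) by auto
  moreover have "set u \<subseteq> C" if "u \<in> set ?new" for u
    using that 3(4,5) by (auto simp: successors_def saturate_def compatible_def)
  then have "\<forall>u\<in>?J. set u \<subseteq> C" using 3(5) by auto
  ultimately obtain I where I: "?J \<subseteq> I" "\<forall>s\<in>I. set s \<subseteq> C \<and> \<not> set F \<subseteq> set s \<and> covers W s I"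
    using 3(1) 3(2) 3(4) by (metis (no_types, lifting) explore.simps(3))
  show ?case
  proof (intro exI conjI)
    show "set (s # todo) \<union> set old \<subseteq> I" using sub I(1) by (rule subset_trans)
  qed (rule I(2))
next
  case (1 W F todo old)
  show ?case by (rule exI[of _ "set old"]) (use 1 in simp)
next
  case (2 x xs W F old)
  show ?case by (rule exI[of _ "set old"]) (use 2 in simp)
qed

text \<open>The added chord \<open>a\<close> crosses no other chord of \<open>Q'\<close>, so the
  part of \<open>s\<close> compatible with \<open>a\<close> still contains the rest of
  \<open>Q'\<close>; connectedness of \<open>Q'\<close> excludes that this list was
  discarded.\<close>

lemma covers_step:
  assumes "covers W s I" "Q \<subseteq> set s" "Q' \<subseteq> insert a Q"
    and Q': "Q' \<subseteq> set W" "pairwise (\<lambda>e f. \<not> interleave e f) Q'" "linked {..<12} Q'"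
    and W: "set W \<subseteq> chords 12" "set s \<subseteq> chords 12"
  shows "\<exists>u\<in>insert s I. Q' \<subseteq> set u"
proof (cases "a \<in> Q' \<and> a \<notin> set s")
  case False
  then show ?thesis using assms(2,3) by blast
next
  case True
  let ?t = "a # compatible a s"
  have "a \<in> set W" using True Q'(1) by blast
  have sub: "Q' \<subseteq> set ?t"
  proof
    fix e assume e: "e \<in> Q'"
    show "e \<in> set ?t"
    proof (cases "e = a")
      case False
      then have "e \<in> set s" using e assms(2,3) by auto
      moreover have "\<not> interleave a e"
        using pairwiseD[OF Q'(2), of a e] True e False by simp
      ultimately show ?thesis by (simp add: compatible_def)
    qed simp
  qed
  have "set ?t \<subseteq> {..<12} \<times> {..<12}"
    using W \<open>a \<in> set W\<close> by (fastforce simp: compatible_def chords_def)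
  then have "linked {..<12} (set ?t) \<longleftrightarrow> Suc (merges ?t) = card {..<12::nat}"
    by (intro linked_iff_merges) (auto simp: lessThan_empty_iff)
  then have "merges ?t = 11"
    using linked_mono[OF Q'(3) sub] by simp
  then obtain u where "u \<in> I" "set ?t \<subseteq> set u"
    using assms(1) True \<open>a \<in> set W\<close> unfolding covers_def by blast
  then show ?thesis using sub by blast
qed

lemma trapped_sound:
  assumes trapped: "trapped A W F"
    and Q: "\<And>t. t \<le> k \<Longrightarrow> Q t \<subseteq> set W \<and> pairwise (\<lambda>e f. \<not> interleave e f) (Q t) \<and> linked {..<12} (Q t)"
    and step: "\<And>t. t < k \<Longrightarrow> \<exists>a. Q (Suc t) \<subseteq> insert a (Q t)"
    and init: "Q 0 \<subseteq> set A" and W: "set W \<subseteq> chords 12" and A: "set A \<subseteq> chords 12"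
  shows "\<not> set F \<subseteq> Q k"
proof -
  have "set (saturate W A) \<subseteq> chords 12"
    using W A by (auto simp: saturate_def)
  then obtain I where I: "saturate W A \<in> I"
    "\<And>s. s \<in> I \<Longrightarrow> set s \<subseteq> chords 12 \<and> \<not> set F \<subseteq> set s \<and> covers W s I"
    using explore_invariant[OF trapped[unfolded trapped_def] _ W] by auto
  have "\<exists>s\<in>I. Q t \<subseteq> set s" if "t \<le> k" for t
    using that
  proof (induction t)
    case 0
    have "Q 0 \<subseteq> set (saturate W A)" using init by (auto simp: saturate_def)
    then show ?case using I(1) by blast
  next
    case (Suc t)
    then obtain s where s: "s \<in> I" "Q t \<subseteq> set s" by auto
    have "t < k" using Suc.prems by simp
    then obtain a where a: "Q (Suc t) \<subseteq> insert a (Q t)" using step by blast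
    have "\<exists>u\<in>insert s I. Q (Suc t) \<subseteq> set u"
      by (rule covers_step[OF _ s(2) a]) (use I(2)[OF s(1)] Q[OF Suc.prems] W in auto)
    then show ?case using s(1) by auto
  qed
  then show ?thesis using I(2) by (metis le_refl subset_trans)
qed

text \<open>The contracted earlier boxes sit at 0 and 6, and the later ones, for
  \<open>upper\<close>, at 4 and 10.\<close>

definition lower :: "chord \<Rightarrow> bool" where
  "lower h \<longleftrightarrow> fst h \<in> {0, 6} \<or> snd h \<in> {0, 6}"

definition upper :: "chord \<Rightarrow> bool" where
  "upper h \<longleftrightarrow> fst h \<in> {4, 10} \<or> snd h \<in> {4, 10}"

section \<open>Finite checks for a single box\<close>

definition spare :: "chord list" where
  "spare = filter (\<lambda>h. h \<notin> set (bridge 1 0 # initial 1 @ final 1))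
     (concat (map (\<lambda>j. map (\<lambda>i. (i, j)) [0..<j]) [0..<12]))"

text \<open>These are exactly the chords that are both \<open>lower\<close> and
  \<open>upper\<close>.\<close>

definition corners :: "chord list" where
  "corners = [(0, 4), (0, 10), (4, 6), (6, 10)]"

text \<open>
  The families below cover all sets of at most two spare chords without a pair \<open>g \<noteq> h\<close> such that
  \<open>\<not> upper g\<close> and \<open>\<not> lower h\<close>. Each is explored in the direction of time that keeps the number of
  graphs small.
\<close>

lemma trapped_corners:
  "trapped (initial 1) (corners @ new_chords 1 @ initial 1) (final 1)"
  by code_simp

lemma trapped_upper:
  "list_all (\<lambda>p. list_all (\<lambda>q. trapped (initial 1)
      (filter (\<lambda>h. upper h \<and> h \<noteq> p \<and> h \<noteq> q) spare @ new_chords 1 @ initial 1) (final 1))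
    [(8, 10), (10, 11)]) [(2, 4), (4, 5)]"
  by code_simp

lemma trapped_lower:
  "list_all (\<lambda>p. list_all (\<lambda>q. trapped (final 1)
      (filter (\<lambda>h. lower h \<and> h \<noteq> p \<and> h \<noteq> q) spare @ old_chords 1 @ final 1) (initial 1))
    [(6, 8), (5, 6)]) [(0, 2), (0, 11)]"
  by code_simp

lemma trapped_pairs:
  "trapped (initial 1) ([(2, 4), (4, 5)] @ new_chords 1 @ initial 1) (final 1)"
  "trapped (initial 1) ([(8, 10), (10, 11)] @ new_chords 1 @ initial 1) (final 1)"
  "trapped (final 1) ([(0, 2), (0, 11)] @ old_chords 1 @ final 1) (initial 1)"
  "trapped (final 1) ([(6, 8), (5, 6)] @ old_chords 1 @ final 1) (initial 1)"
  by code_simp+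

lemma trapped_inner:
  "list_all (\<lambda>h. if h \<in> set [(1, 2), (1, 5), (7, 8), (7, 11)]
      then trapped (final 1) ((h # corners) @ old_chords 1 @ final 1) (initial 1)
      else trapped (initial 1) ((h # corners) @ new_chords 1 @ initial 1) (final 1))
    (filter (\<lambda>h. \<not> lower h \<and> \<not> upper h) spare)"
  by code_simp

section \<open>Sequences of contracted graphs\<close>

lemma set_all_chords: "set (concat (map (\<lambda>j. map (\<lambda>i. (i, j)) [0..<j]) [0..<n])) = chords n"
  by (auto simp: chords_def)

lemma set_spare: "set spare = chords 12 - insert (bridge 1 0) (set (initial 1) \<union> set (final 1))"
  unfolding spare_def set_filter set_all_chords by auto

text \<open>The bound on added chords is imposed in both directions of time, so that a reversed
  passage is again one and the backward explorations apply.\<close>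

definition passage :: "nat \<Rightarrow> (nat \<Rightarrow> chord set) \<Rightarrow> chord set \<Rightarrow> bool" where
  "passage k Q H \<longleftrightarrow>
     (\<forall>t\<le>k. Q t \<subseteq> H \<union> set (initial 1) \<union> set (final 1) \<and>
        pairwise (\<lambda>e f. \<not> interleave e f) (Q t) \<and> linked {..<12} (Q t)) \<and>
     (\<forall>t<k. \<exists>a. Q (Suc t) \<subseteq> insert a (Q t)) \<and> (\<forall>t<k. \<exists>a. Q t \<subseteq> insert a (Q (Suc t)))"

lemma passage_mono: "passage k Q H \<Longrightarrow> H \<subseteq> H' \<Longrightarrow> passage k Q H'"
  unfolding passage_def by fast

lemma passage_reverse:
  assumes "passage k Q H"
  shows "passage k (\<lambda>t. Q (k - t)) H"
proof -
  have "\<exists>a. Q (k - Suc t) \<subseteq> insert a (Q (k - t))" "\<exists>a. Q (k - t) \<subseteq> insert a (Q (k - Suc t))"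
    if "t < k" for t
  proof -
    have "k - t = Suc (k - Suc t)" "k - Suc t < k" using that by simp_all
    then show "\<exists>a. Q (k - Suc t) \<subseteq> insert a (Q (k - t))" "\<exists>a. Q (k - t) \<subseteq> insert a (Q (k - Suc t))"
      using assms unfolding passage_def by metis+
  qed
  then show ?thesis using assms unfolding passage_def by (meson diff_le_self)
qed

lemma initial_1: "set (initial 1) \<subseteq> chords 12" "set (final 1) \<subseteq> chords 12"
proof -
  have "list_all (\<lambda>(i, j). i < j \<and> j < 12) (initial 1 @ final 1)" by code_simp
  then show "set (initial 1) \<subseteq> chords 12" "set (final 1) \<subseteq> chords 12"
    by (auto simp: list_all_iff chords_def)
qed

lemma set_initial_final:
  "set (new_chords r) \<union> set (initial r) = set (initial r) \<union> set (final r)"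
  "set (old_chords r) \<union> set (final r) = set (initial r) \<union> set (final r)"
  by (auto simp: initial_def final_def)

lemma trapped_passage:
  assumes "trapped A (H @ W) F" "passage k Q (set H)" "Q 0 \<subseteq> set A" "set F \<subseteq> Q k"
    and "set H \<subseteq> chords 12" "set W = set (initial 1) \<union> set (final 1)"
    and "A \<in> {initial 1, final 1}"
  shows False
proof -
  have "\<not> set F \<subseteq> Q k"
  proof (rule trapped_sound[OF assms(1)])
    fix t assume "t \<le> k"
    then have "Q t \<subseteq> set H \<union> set (initial 1) \<union> set (final 1)"
      "pairwise (\<lambda>e f. \<not> interleave e f) (Q t)" "linked {..<12} (Q t)"
      using assms(2) unfolding passage_def by blast+
    then show "Q t \<subseteq> set (H @ W) \<and> pairwise (\<lambda>e f. \<not> interleave e f) (Q t) \<and> linked {..<12} (Q t)"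
      using assms(6) by auto
  next
    show "\<exists>a. Q (Suc t) \<subseteq> insert a (Q t)" if "t < k" for t
      using assms(2) that unfolding passage_def by blast
  qed (use assms initial_1 in auto)
  then show False using assms(4) by blast
qed

definition blocked :: "chord list \<Rightarrow> bool" where
  "blocked H \<longleftrightarrow> trapped (initial 1) (H @ new_chords 1 @ initial 1) (final 1) \<or>
     trapped (final 1) (H @ old_chords 1 @ final 1) (initial 1)"

lemma blocked_passage:
  assumes "blocked H" "set H \<subseteq> chords 12" "passage k Q (set H)"
    and "Q 0 = set (initial 1)" "Q k = set (final 1)"
  shows False
  using assms(1) unfolding blocked_def
proof
  assume "trapped (initial 1) (H @ new_chords 1 @ initial 1) (final 1)"
  then show False
    by (rule trapped_passage[OF _ assms(3)]) (use assms set_initial_final in auto)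
next
  assume "trapped (final 1) (H @ old_chords 1 @ final 1) (initial 1)"
  then show False
    by (rule trapped_passage[OF _ passage_reverse[OF assms(3)]]) (use assms set_initial_final in auto)
qed

text \<open>Any set of spare chords violating a conclusion lies in one of the explored families,
  from which the other tree is out of reach.\<close>

lemma passage_chords:
  assumes P: "passage k Q H" "Q 0 = set (initial 1)" "Q k = set (final 1)" and H: "H \<subseteq> set spare"
  shows "\<not> H \<subseteq> set corners"
    and "(\<exists>g\<in>H. \<exists>h\<in>H. g \<noteq> h \<and> \<not> upper g \<and> \<not> lower h) \<or> 3 \<le> card H"
proof -
  have stuck: "\<not> H \<subseteq> set K" if "blocked K" "set K \<subseteq> chords 12" for K
    using blocked_passage[OF that passage_mono[OF P(1)] P(2,3)] by blast
  have spare: "set spare \<subseteq> chords 12" using set_spare by blast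
  have corners: "set corners \<subseteq> chords 12" by (simp add: corners_def chords_def)
  show "\<not> H \<subseteq> set corners"
    by (rule stuck) (use trapped_corners corners in \<open>auto simp: blocked_def\<close>)
  \<comment> \<open>The exploration with only \<open>a\<close> and \<open>b\<close> never arrives,
    so a passage that uses both needs a third spare chord.\<close>
  have pair: "3 \<le> card H" if "a \<in> H" "b \<in> H" "a \<noteq> b" "blocked [a, b]" for a b
  proof (rule ccontr)
    assume "\<not> 3 \<le> card H"
    have "{a, b} \<subseteq> H" "card {a, b} = 2" using that by auto
    moreover have "finite H" using H finite_subset by blast
    ultimately have "{a, b} = H"
      using \<open>\<not> 3 \<le> card H\<close> by (intro card_seteq) auto
    then show False using stuck[OF that(4)] H spare by auto
  qed
  show "(\<exists>g\<in>H. \<exists>h\<in>H. g \<noteq> h \<and> \<not> upper g \<and> \<not> lower h) \<or> 3 \<le> card H"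
  proof (rule ccontr)
    assume neg: "\<not> ((\<exists>g\<in>H. \<exists>h\<in>H. g \<noteq> h \<and> \<not> upper g \<and> \<not> lower h) \<or> 3 \<le> card H)"
    then have no: "upper g \<or> lower h" if "g \<in> H" "h \<in> H" "g \<noteq> h" for g h using that by blast
    have card: "\<not> 3 \<le> card H" using neg by blast
    \<comment> \<open>A chord that is neither upper nor lower forces every other one to be both. If
      there is none, a single chord that is not upper forces all chords to be lower.\<close>
    consider (inner) g where "g \<in> H" "\<not> upper g" "\<not> lower g"
      | (upper) "\<forall>g\<in>H. upper g" | (lower) "\<forall>g\<in>H. lower g"
      using no by blast
    then show False
    proof cases
      case inner
      have "H \<subseteq> set (g # corners)"
      proof
        fix h assume h: "h \<in> H"
        show "h \<in> set (g # corners)"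
        proof (cases "h = g")
          case False
          then have "upper h" "lower h" using no inner h by blast+
          moreover have "fst h < snd h" using h H spare by (fastforce simp: chords_def)
          ultimately show ?thesis by (cases h) (auto simp: upper_def lower_def corners_def)
        qed simp
      qed
      moreover have "g \<in> set (filter (\<lambda>h. \<not> lower h \<and> \<not> upper h) spare)"
        using inner H by auto
      from bspec[OF trapped_inner[unfolded list_all_iff] this] have "blocked (g # corners)"
        unfolding blocked_def by (auto split: if_splits)
      moreover have "set (g # corners) \<subseteq> chords 12" using inner H spare corners by auto
      ultimately show False using stuck by blast
    next
      case upper
      have "H \<subseteq> set (filter (\<lambda>h. upper h \<and> h \<noteq> p \<and> h \<noteq> q) spare)"
        if "p \<notin> H" "q \<notin> H" for p q using that upper H by auto
      moreover have "blocked (filter (\<lambda>h. upper h \<and> h \<noteq> p \<and> h \<noteq> q) spare)"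
        if "p \<in> {(2, 4), (4, 5)}" "q \<in> {(8, 10), (10, 11)}" for p q
        using trapped_upper that by (auto simp: list_all_iff blocked_def)
      moreover have "set (filter (\<lambda>h. upper h \<and> h \<noteq> p \<and> h \<noteq> q) spare) \<subseteq> chords 12" for p q
        using spare by auto
      ultimately have "p \<in> H \<or> q \<in> H" if "p \<in> {(2, 4), (4, 5)}" "q \<in> {(8, 10), (10, 11)}" for p q
        using stuck that by meson
      \<comment> \<open>Each of the four choices of \<open>p\<close> and \<open>q\<close> has a
        member in \<open>H\<close>, so one of the two lists lies in \<open>H\<close>
        entirely.\<close>
      then have "(2, 4) \<in> H \<and> (4, 5) \<in> H \<or> (8, 10) \<in> H \<and> (10, 11) \<in> H" by blast
      then show False
        using pair[of "(2, 4)" "(4, 5)"] pair[of "(8, 10)" "(10, 11)"] card trapped_pairs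
        by (auto simp: blocked_def)
    next
      case lower
      have "H \<subseteq> set (filter (\<lambda>h. lower h \<and> h \<noteq> p \<and> h \<noteq> q) spare)"
        if "p \<notin> H" "q \<notin> H" for p q using that lower H by auto
      moreover have "blocked (filter (\<lambda>h. lower h \<and> h \<noteq> p \<and> h \<noteq> q) spare)"
        if "p \<in> {(0, 2), (0, 11)}" "q \<in> {(6, 8), (5, 6)}" for p q
        using trapped_lower that by (auto simp: list_all_iff blocked_def)
      moreover have "set (filter (\<lambda>h. lower h \<and> h \<noteq> p \<and> h \<noteq> q) spare) \<subseteq> chords 12" for p q
        using spare by auto
      ultimately have "p \<in> H \<or> q \<in> H" if "p \<in> {(0, 2), (0, 11)}" "q \<in> {(6, 8), (5, 6)}" for p q
        using stuck that by meson
      then have "(0, 2) \<in> H \<and> (0, 11) \<in> H \<or> (6, 8) \<in> H \<and> (5, 6) \<in> H" by blast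
      then show False
        using pair[of "(0, 2)" "(0, 11)"] pair[of "(6, 8)" "(5, 6)"] card trapped_pairs
        by (auto simp: blocked_def)
    qed
  qed
qed

text \<open>Adding a chord of the other tree and discarding what it crosses leaves a disconnected
  graph, so without spare chords and bridge a box is stuck in its state.\<close>

lemma passage_idle:
  assumes "passage k Q {}"
  shows "Q 0 \<subseteq> set (initial 1) \<Longrightarrow> t \<le> k \<Longrightarrow> Q t \<subseteq> set (initial 1)"
    and "Q 0 \<subseteq> set (final 1) \<Longrightarrow> t \<le> k \<Longrightarrow> Q t \<subseteq> set (final 1)"
proof -
  have "Q t \<subseteq> set s" if "covers (initial 1 @ final 1) s {s}" "s \<in> {initial 1, final 1}"
    "Q 0 \<subseteq> set s" "t \<le> k" for s t
    using that(4)
  proof (induction t)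
    case (Suc t)
    have "t < k" "Q t \<subseteq> set s" using Suc by simp_all
    then obtain a where a: "Q (Suc t) \<subseteq> insert a (Q t)" using assms unfolding passage_def by blast
    have "\<exists>u\<in>insert s {s}. Q (Suc t) \<subseteq> set u"
      by (rule covers_step[OF that(1) \<open>Q t \<subseteq> set s\<close> a])
         (use assms Suc.prems that(2) initial_1 in \<open>auto simp: passage_def\<close>)
    then show ?case by simp
  qed (use that in simp)
  moreover have "covers (initial 1 @ final 1) (initial 1) {initial 1}"
    "covers (initial 1 @ final 1) (final 1) {final 1}"
  proof -
    have "list_all (\<lambda>s. list_all (\<lambda>a. a \<in> set s \<or> merges (a # compatible a s) \<noteq> 11)
        (initial 1 @ final 1)) [initial 1, final 1]" by code_simp
    then show "covers (initial 1 @ final 1) (initial 1) {initial 1}"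
      "covers (initial 1 @ final 1) (final 1) {final 1}"
      unfolding covers_def list_all_iff list.set by blast+
  qed
  ultimately show "Q 0 \<subseteq> set (initial 1) \<Longrightarrow> t \<le> k \<Longrightarrow> Q t \<subseteq> set (initial 1)"
    and "Q 0 \<subseteq> set (final 1) \<Longrightarrow> t \<le> k \<Longrightarrow> Q t \<subseteq> set (final 1)"
    by blast+
qed

section \<open>Outside edges of short flip sequences\<close>

definition flip_path :: "nat \<Rightarrow> nat \<Rightarrow> (nat \<Rightarrow> chord set) \<Rightarrow> bool" where
  "flip_path r k G \<longleftrightarrow> G 0 = set (initial r) \<and> G k = set (final r) \<and>
     (\<forall>t\<le>k. tree (10 * r + 2) (G t)) \<and>
     (\<forall>t<k. \<exists>e f. e \<in> G t \<and> f \<notin> G t \<and> G (Suc t) = insert f (G t - {e}))"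

text \<open>Such a chord is spare in the view of box \<open>i\<close>; only these chords and the
  bridge of the box can help to rearrange it.\<close>

definition foreign :: "nat \<Rightarrow> nat \<Rightarrow> chord \<Rightarrow> bool" where
  "foreign r i h \<longleftrightarrow> \<not> loop r i h \<and>
     collapse r i h \<notin> insert (bridge 1 0) (set (initial 1) \<union> set (final 1))"

lemma set_map_filter_collapse: "set (map (collapse r i) (filter (\<lambda>e. \<not> loop r i e) es)) = quot r i (set es)"
  by (simp add: quot_def)

text \<open>All boxes yield the same pair of trees on 12 points, so one set of explorations serves
  them all.\<close>

lemma quot_initial_final:
  assumes "r \<in> {2, 3}" "i < r"
  shows "quot r i (set (initial r)) = set (initial 1)" "quot r i (set (final r)) = set (final 1)"
proof -
  have "list_all (\<lambda>(r, i).
      let A = map (collapse r i) (filter (\<lambda>e. \<not> loop r i e) (initial r));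
          B = map (collapse r i) (filter (\<lambda>e. \<not> loop r i e) (final r))
      in (\<forall>e\<in>set A. e \<in> set (initial 1)) \<and> (\<forall>e\<in>set (initial 1). e \<in> set A) \<and>
         (\<forall>e\<in>set B. e \<in> set (final 1)) \<and> (\<forall>e\<in>set (final 1). e \<in> set B))
    [(2, 0), (2, 1), (3, 0), (3, 1), (3, 2)]"
    by code_simp
  moreover have "(r, i) \<in> set [(2, 0), (2, 1), (3, 0), (3, 1), (3, 2)]"
    using assms by auto
  ultimately have "let A = map (collapse r i) (filter (\<lambda>e. \<not> loop r i e) (initial r));
          B = map (collapse r i) (filter (\<lambda>e. \<not> loop r i e) (final r))
      in (\<forall>e\<in>set A. e \<in> set (initial 1)) \<and> (\<forall>e\<in>set (initial 1). e \<in> set A) \<and>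
         (\<forall>e\<in>set B. e \<in> set (final 1)) \<and> (\<forall>e\<in>set (final 1). e \<in> set B)"
    unfolding list_all_iff by blast
  then show "quot r i (set (initial r)) = set (initial 1)" "quot r i (set (final r)) = set (final 1)"
    unfolding Let_def set_map_filter_collapse by blast+
qed

lemma quot_mono: "G \<subseteq> G' \<Longrightarrow> quot r i G \<subseteq> quot r i G'"
  by (auto simp: quot_def)

lemma quot_insert: "quot r i (insert e G) \<subseteq> insert (collapse r i e) (quot r i G)"
  by (auto simp: quot_def)

lemma quot_passage:
  assumes G: "flip_path r k G" and i: "i < r" and ab: "a \<le> b" "b \<le> k"
    and X: "\<And>t. a \<le> t \<Longrightarrow> t \<le> b \<Longrightarrow> quot r i (G t) \<subseteq> X \<union> set (initial 1) \<union> set (final 1)"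
  shows "passage (b - a) (\<lambda>t. quot r i (G (a + t))) X"
  unfolding passage_def
proof (intro conjI allI impI)
  fix t assume t: "t \<le> b - a"
  then have tree: "tree (10 * r + 2) (G (a + t))" using G ab unfolding flip_path_def by simp
  then have pw: "pairwise (\<lambda>e f. \<not> interleave e f) (G (a + t))"
    and sub: "G (a + t) \<subseteq> chords (10 * r + 2)" unfolding tree_def by simp_all
  show "quot r i (G (a + t)) \<subseteq> X \<union> set (initial 1) \<union> set (final 1)"
    using X[of "a + t"] t ab by simp
  show "linked {..<12} (quot r i (G (a + t)))"
    using tree linked_quot[OF i] unfolding tree_def by blast
  show "pairwise (\<lambda>e f. \<not> interleave e f) (quot r i (G (a + t)))"
  proof (rule pairwiseI)
    fix e f assume "e \<in> quot r i (G (a + t))" "f \<in> quot r i (G (a + t))" "e \<noteq> f"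
    then obtain e' f' where "e' \<in> G (a + t)" "f' \<in> G (a + t)" "\<not> loop r i e'" "\<not> loop r i f'"
      "e = collapse r i e'" "f = collapse r i f'" "e' \<noteq> f'"
      unfolding quot_def by blast
    moreover from this have "\<not> interleave e' f'" using pairwiseD[OF pw, of e' f'] by simp
    ultimately show "\<not> interleave e f"
      using interleave_collapse[OF i, of e' "10 * r + 2" f'] sub by (meson subsetD)
  qed
next
  fix t assume t: "t < b - a"
  then obtain e f where ef: "e \<in> G (a + t)" "G (Suc (a + t)) = insert f (G (a + t) - {e})"
    using G ab unfolding flip_path_def by (metis (no_types, lifting) less_diff_conv add.commute order_less_le_trans)
  have "quot r i (G (a + Suc t)) \<subseteq> quot r i (insert f (G (a + t)))"
    by (rule quot_mono) (use ef in auto)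
  then show "\<exists>c. quot r i (G (a + Suc t)) \<subseteq> insert c (quot r i (G (a + t)))"
    using quot_insert by blast
  have "quot r i (G (a + t)) \<subseteq> quot r i (insert e (G (a + Suc t)))"
    by (rule quot_mono) (use ef in auto)
  then show "\<exists>c. quot r i (G (a + t)) \<subseteq> insert c (quot r i (G (a + Suc t)))"
    using quot_insert by blast
qed

lemma upper_collapse:
  "upper (collapse r i h) \<longleftrightarrow> proj r i (fst h) \<in> {4, 10} \<or> proj r i (snd h) \<in> {4, 10}"
  by (auto simp: upper_def collapse_def min_def max_def)

lemma lower_collapse:
  "lower (collapse r i h) \<longleftrightarrow> proj r i (fst h) \<in> {0, 6} \<or> proj r i (snd h) \<in> {0, 6}"
  by (auto simp: lower_def collapse_def min_def max_def)

text \<open>In the view of box \<open>j\<close> both ends are contracted to 0 or 6, which leaves a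
  loop or the chord \<open>(0, 6)\<close> of the initial tree.\<close>

lemma not_foreign_later:
  assumes "i < j" "j < r" "h \<in> chords (10 * r + 2)" "\<not> upper (collapse r i h)"
  shows "\<not> foreign r j h"
proof -
  have "fst h < 10 * r + 2" "snd h < 10 * r + 2" using assms(3) by (auto simp: chords_def)
  then have "proj r j (fst h) \<in> {0, 6}" "proj r j (snd h) \<in> {0, 6}"
    using assms proj_later[of i j r] upper_collapse by blast+
  moreover have "(0, 6) \<in> set (initial 1)" by (simp add: initial_def old_chords_def)
  ultimately show ?thesis by (auto simp: foreign_def loop_def collapse_def)
qed

text \<open>Here a loop or the chord \<open>(4, 10)\<close> of the final tree remains.\<close>

lemma not_foreign_earlier:
  assumes "j < i" "i < r" "h \<in> chords (10 * r + 2)" "\<not> lower (collapse r i h)"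
  shows "\<not> foreign r j h"
proof -
  have "fst h < 10 * r + 2" "snd h < 10 * r + 2" using assms(3) by (auto simp: chords_def)
  then have "proj r j (fst h) \<in> {4, 10}" "proj r j (snd h) \<in> {4, 10}"
    using assms proj_earlier[of j i r] lower_collapse by blast+
  moreover have "(4, 10) \<in> set (final 1)" by (simp add: final_def new_chords_def)
  ultimately show ?thesis by (auto simp: foreign_def loop_def collapse_def)
qed

lemma bridge_in_chords: "i < r \<Longrightarrow> bridge r i \<in> chords (10 * r + 2)"
  by (auto simp: bridge_def chords_def apex_def base_def)

lemma collapse_bridge_iff:
  assumes "i < r" "h \<in> chords (10 * r + 2)"
  shows "collapse r i h = bridge 1 0 \<longleftrightarrow> h = bridge r i"
proof -
  obtain a b where h: "h = (a, b)" "a < b" "b < 10 * r + 2" using assms(2) by (auto simp: chords_def)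
  have "bridge 1 0 = (5, 11)" by (simp add: bridge_def apex_def base_def)
  moreover have "apex r i < base r i" using assms(1) by (simp add: apex_def base_def)
  ultimately show ?thesis
    using proj_apex_iff[OF assms(1), of a] proj_base_iff[OF assms(1), of b]
      proj_apex_iff[OF assms(1), of b] proj_base_iff[OF assms(1), of a] h
    by (auto simp: collapse_def bridge_def min_def max_def split: if_splits)
qed

lemma not_foreign_bridge:
  assumes "i < r" "j < r"
  shows "\<not> foreign r i (bridge r j)"
proof (cases i j rule: linorder_cases)
  case equal
  then show ?thesis using collapse_bridge_iff[OF assms(1) bridge_in_chords] assms(1)
    by (simp add: foreign_def)
next
  case less
  have "collapse r j (bridge r j) = (5, 11)"
    using collapse_bridge_iff[OF assms(2) bridge_in_chords] assms(2)
    by (simp add: bridge_def apex_def base_def)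
  then show ?thesis
    using less assms bridge_in_chords by (intro not_foreign_earlier[of i j]) (auto simp: lower_def)
next
  case greater
  have "collapse r j (bridge r j) = (5, 11)"
    using collapse_bridge_iff[OF assms(2) bridge_in_chords] assms(2)
    by (simp add: bridge_def apex_def base_def)
  then show ?thesis
    using greater assms bridge_in_chords by (intro not_foreign_later[of j i]) (auto simp: upper_def)
qed

lemma bridge_inj: "i < r \<Longrightarrow> j < r \<Longrightarrow> bridge r i = bridge r j \<longleftrightarrow> i = j"
  by (auto simp: bridge_def apex_def)

lemma bridges_interleave: "i < j \<Longrightarrow> j < r \<Longrightarrow> interleave (bridge r i) (bridge r j)"
  by (auto simp: bridge_def apex_def base_def)

section \<open>Counting the outside chords\<close>

definition outside :: "nat \<Rightarrow> nat \<Rightarrow> (nat \<Rightarrow> chord set) \<Rightarrow> chord set" where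
  "outside r k G = (\<Union>t\<le>k. G t) - (set (initial r) \<union> set (final r))"

lemma flip_path_chords:
  assumes "flip_path r k G" "t \<le> k"
  shows "G t \<subseteq> chords (10 * r + 2)"
  using assms unfolding flip_path_def tree_def by blast

lemma outside_chords:
  assumes "flip_path r k G"
  shows "outside r k G \<subseteq> chords (10 * r + 2)"
  using flip_path_chords[OF assms] unfolding outside_def by blast

lemma finite_outside: "flip_path r k G \<Longrightarrow> finite (outside r k G)"
  using outside_chords finite_chords finite_subset by metis

text \<open>If its bridge never occurs, box \<open>i\<close> undergoes a passage whose spare chords
  are images of foreign outside chords. Contraction may identify chords, so a lower bound for the
  images also holds for the originals.\<close>

lemma foreign_chords:
  assumes r: "r \<in> {2, 3}" and G: "flip_path r k G" and i: "i < r"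
    and b: "bridge r i \<notin> outside r k G"
  defines "H \<equiv> {h \<in> outside r k G. foreign r i h}"
  shows "\<exists>h\<in>H. collapse r i h \<notin> set corners"
    and "(\<exists>g\<in>H. \<exists>h\<in>H. g \<noteq> h \<and> \<not> upper (collapse r i g) \<and> \<not> lower (collapse r i h)) \<or> 3 \<le> card H"
proof -
  let ?K = "collapse r i ` H"
  have fin: "finite H" using finite_outside[OF G] by (simp add: H_def)
  have sub: "quot r i (G t) \<subseteq> ?K \<union> set (initial 1) \<union> set (final 1)" if "t \<le> k" for t
  proof
    fix c assume "c \<in> quot r i (G t)"
    then obtain e where e: "e \<in> G t" "\<not> loop r i e" "c = collapse r i e" by (auto simp: quot_def)
    show "c \<in> ?K \<union> set (initial 1) \<union> set (final 1)"
    proof (cases "e \<in> set (initial r) \<union> set (final r)")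
      case True
      then have "c \<in> quot r i (set (initial r)) \<union> quot r i (set (final r))"
        using e by (auto simp: quot_def)
      then show ?thesis using quot_initial_final[OF r i] by blast
    next
      case False
      then have out: "e \<in> outside r k G" using e(1) that by (auto simp: outside_def)
      then have "e \<in> chords (10 * r + 2)" using outside_chords[OF G] by (rule subsetD[rotated])
      then have "c \<noteq> bridge 1 0" using collapse_bridge_iff[OF i, of e] b out e(3) by metis
      then show ?thesis using e out by (auto simp: H_def foreign_def)
    qed
  qed
  have "passage (k - 0) (\<lambda>t. quot r i (G (0 + t))) ?K"
    by (rule quot_passage[OF G i]) (use sub in auto)
  then have P: "passage k (\<lambda>t. quot r i (G t)) ?K" by simp
  have Q: "quot r i (G 0) = set (initial 1)" "quot r i (G k) = set (final 1)"
    using G quot_initial_final[OF r i] by (simp_all add: flip_path_def)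
  have "?K \<subseteq> set spare"
    unfolding set_spare H_def using collapse_in_chords by (auto simp: foreign_def)
  note * = passage_chords[OF P Q this]
  show "\<exists>h\<in>H. collapse r i h \<notin> set corners" using *(1) by blast
  show "(\<exists>g\<in>H. \<exists>h\<in>H. g \<noteq> h \<and> \<not> upper (collapse r i g) \<and> \<not> lower (collapse r i h)) \<or> 3 \<le> card H"
    using *(2)
  proof
    assume "\<exists>g\<in>?K. \<exists>h\<in>?K. g \<noteq> h \<and> \<not> upper g \<and> \<not> lower h"
    then obtain g h where "g \<in> H" "h \<in> H" "collapse r i g \<noteq> collapse r i h"
      "\<not> upper (collapse r i g)" "\<not> lower (collapse r i h)" by blast
    then show ?thesis by metis
  next
    assume "3 \<le> card ?K"
    then have "3 \<le> card H" using card_image_le[OF fin, of "collapse r i"] by linarith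
    then show ?thesis ..
  qed
qed

text \<open>Missing bridges cost more than they save. If every box without its bridge has a pair of
  chords as in \<open>foreign_chords\<close>, there is at least one outside chord too many;
  otherwise three outside chords have to serve all three boxes at once, which fails for the middle
  one.\<close>

lemma outside_eq_bridges:
  assumes r: "r \<in> {2, 3}" and G: "flip_path r k G" and card: "card (outside r k G) \<le> r"
  shows "outside r k G = bridge r ` {..<r}"
proof -
  define H where "H = outside r k G"
  have fin: "finite H" using finite_outside[OF G] by (simp add: H_def)
  have chords: "h \<in> chords (10 * r + 2)" if "h \<in> H" for h
    using that outside_chords[OF G] by (auto simp: H_def)
  define N where "N = {i. i < r \<and> bridge r i \<notin> H}"
  have "finite N" by (simp add: N_def)
  have inj: "inj_on (bridge r) {..<r}" using bridge_inj by (auto simp: inj_on_def)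
  have "N = {}"
  proof (rule ccontr)
    assume "N \<noteq> {}"
    show False
    proof (cases "\<forall>i\<in>N. \<exists>g\<in>H. \<exists>h\<in>H. g \<noteq> h \<and> foreign r i g \<and> foreign r i h \<and>
        \<not> upper (collapse r i g) \<and> \<not> lower (collapse r i h)")
      case True
      then obtain g h where gh: "\<And>i. i \<in> N \<Longrightarrow> g i \<in> H \<and> h i \<in> H \<and> g i \<noteq> h i \<and>
        foreign r i (g i) \<and> foreign r i (h i) \<and>
        \<not> upper (collapse r i (g i)) \<and> \<not> lower (collapse r i (h i))"
        by metis
      \<comment> \<open>Since \<open>h i\<close> is foreign to no earlier box, the chords
        \<open>h i\<close> are pairwise different, and \<open>g m\<close> for the least box
        \<open>m\<close> differs from all of them. Together with the bridges of the other boxes they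
        make \<open>r + 1\<close> outside chords.\<close>
      define m where "m = Min N"
      have m: "m \<in> N" "\<And>i. i \<in> N \<Longrightarrow> m \<le> i"
        using \<open>finite N\<close> \<open>N \<noteq> {}\<close> by (auto simp: m_def)
      have hr: "\<not> foreign r j (h i)" if "i \<in> N" "j < i" for i j
        using not_foreign_earlier[of j i r "h i"] that gh[of i] chords by (auto simp: N_def)
      have "inj_on h N"
      proof (rule linorder_inj_onI')
        fix i j assume "i \<in> N" "j \<in> N" "i < j"
        then show "h i \<noteq> h j" using hr[of j i] gh[of i] by auto
      qed
      have "g m \<notin> h ` N"
      proof
        assume "g m \<in> h ` N"
        then obtain i where i: "i \<in> N" "g m = h i" by blast
        then have "i \<noteq> m" using gh[of m] by auto
        then have "m < i" using m(2)[OF i(1)] by simp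
        then show False using hr[of i m] i gh[of m] m(1) by auto
      qed
      then have "card (insert (g m) (h ` N)) = Suc (card N)"
        using \<open>finite N\<close> by (simp add: card_image[OF \<open>inj_on h N\<close>])
      moreover have "bridge r ` ({..<r} - N) \<inter> insert (g m) (h ` N) = {}"
      proof (rule equals0I)
        fix x assume "x \<in> bridge r ` ({..<r} - N) \<inter> insert (g m) (h ` N)"
        then obtain j where j: "j < r" "x = bridge r j" and "x = g m \<or> (\<exists>i\<in>N. x = h i)" by blast
        then obtain i where "i \<in> N" "foreign r i x" using gh m(1) by metis
        then show False using not_foreign_bridge[of i r j] j by (simp add: N_def)
      qed
      moreover have "N \<subseteq> {..<r}" by (auto simp: N_def)
      then have "card ({..<r} - N) = r - card N"
        using card_Diff_subset[OF \<open>finite N\<close>, of "{..<r}"] by simp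
      then have "card (bridge r ` ({..<r} - N)) = r - card N"
        using card_image[OF inj_on_subset[OF inj, of "{..<r} - N"]] by simp
      moreover have "card N \<le> r"
        using card_mono[of "{..<r}" N] by (auto simp: N_def)
      ultimately have "card (bridge r ` ({..<r} - N) \<union> insert (g m) (h ` N)) = Suc r"
        using \<open>finite N\<close> by (subst card_Un_disjoint) auto
      moreover have "bridge r ` ({..<r} - N) \<union> insert (g m) (h ` N) \<subseteq> H"
        using gh m(1) by (auto simp: N_def)
      ultimately have "Suc r \<le> card H" using card_mono[OF fin] by metis
      then show False using card by (simp add: H_def)
    next
      case False
      then obtain i where i: "i \<in> N" and none: "\<not> (\<exists>g\<in>H. \<exists>h\<in>H. g \<noteq> h \<and> foreign r i g \<and>
        foreign r i h \<and> \<not> upper (collapse r i g) \<and> \<not> lower (collapse r i h))" by blast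
      \<comment> \<open>Three foreign chords exhaust the at most \<open>r\<close> outside
        chords.\<close>
      have full: "r = 3 \<and> (\<forall>h\<in>H. foreign r j h)"
        if j: "j < r" "bridge r j \<notin> H" and none: "\<not> (\<exists>g\<in>H. \<exists>h\<in>H. g \<noteq> h \<and> foreign r j g \<and>
        foreign r j h \<and> \<not> upper (collapse r j g) \<and> \<not> lower (collapse r j h))" for j
      proof -
        have "3 \<le> card {h \<in> H. foreign r j h}"
          using foreign_chords(2)[OF r G j(1)] j(2) none by (auto simp: H_def)
        moreover have "card {h \<in> H. foreign r j h} \<le> card H"
          using fin by (intro card_mono) auto
        ultimately have "r = 3" "card H \<le> card {h \<in> H. foreign r j h}"
          using card r by (auto simp: H_def)
        moreover from this have "{h \<in> H. foreign r j h} = H"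
          using fin by (intro card_seteq) auto
        ultimately show ?thesis by blast
      qed
      have fi: "r = 3" "\<And>h. h \<in> H \<Longrightarrow> foreign r i h" and "i < r"
        using full[OF _ _ none] i by (auto simp: N_def)
      have no_bridge: "bridge r j \<notin> H" if "j < r" for j
        using fi(2) not_foreign_bridge[OF \<open>i < r\<close> that] by blast
      \<comment> \<open>A pair for box \<open>j\<close> has a chord foreign to no later box and one
        foreign to no earlier box. Both are foreign to \<open>i\<close>, which leaves
        \<open>j = i\<close>.\<close>
      have all: "foreign r j h" if "j < r" "h \<in> H" for j h
      proof (cases "\<exists>g\<in>H. \<exists>h\<in>H. g \<noteq> h \<and> foreign r j g \<and>
        foreign r j h \<and> \<not> upper (collapse r j g) \<and> \<not> lower (collapse r j h)")
        case True
        then obtain g' h' where gh: "g' \<in> H" "h' \<in> H" "foreign r j g'" "foreign r j h'"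
          "g' \<noteq> h'" "\<not> upper (collapse r j g')" "\<not> lower (collapse r j h')" by blast
        then have "\<not> j < i" "\<not> i < j"
          using not_foreign_later[of j i r g'] not_foreign_earlier[of i j r h'] chords fi(2)
            \<open>i < r\<close> that(1) by blast+
        then show ?thesis using fi(2) that(2) by (metis linorder_neqE_nat)
      next
        case False
        then show ?thesis using full[OF that(1) no_bridge[OF that(1)] False] that(2) by blast
      qed
      \<comment> \<open>In the view of the middle box, a chord foreign to both neighbours touches
        both sides and is a corner; but corners alone do not suffice.\<close>
      have "collapse r 1 h \<in> set corners" if h: "h \<in> H" for h
      proof -
        have "upper (collapse r 1 h)" "lower (collapse r 1 h)"
          using not_foreign_later[of 1 2 r h] not_foreign_earlier[of 0 1 r h] all h chords fi(1)
          by auto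
        moreover have "collapse r 1 h \<in> chords 12"
          using all[of 1 h] h fi(1) collapse_in_chords by (auto simp: foreign_def)
        ultimately show ?thesis
          by (cases "collapse r 1 h") (auto simp: upper_def lower_def corners_def chords_def)
      qed
      then show False
        using foreign_chords(1)[OF r G, of 1] no_bridge[of 1] fi(1) by (auto simp: H_def)
    qed
  qed
  then have sub: "bridge r ` {..<r} \<subseteq> H" by (auto simp: N_def)
  moreover have "card (bridge r ` {..<r}) = r" using inj by (simp add: card_image)
  ultimately have "bridge r ` {..<r} = H"
    using card fin by (intro card_seteq) (auto simp: H_def)
  then show ?thesis by (simp add: H_def)
qed

section \<open>Traces\<close>

lemma first_entry:
  assumes flips: "\<And>t. t < k \<Longrightarrow> G (Suc t) \<subseteq> insert (f t) (G t)"
    and "s \<le> t" "t \<le> k" "h \<notin> G s" "h \<in> G t"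
  shows "\<exists>u. s \<le> u \<and> u < t \<and> h = f u"
  using assms(2-)
proof (induction t rule: dec_induct)
  case (step t)
  show ?case
  proof (cases "h \<in> G t")
    case True
    then show ?thesis using step by (meson Suc_leD less_SucI)
  next
    case False
    then have "h = f t" using step.prems flips[of t] by auto
    then show ?thesis using step.hyps by blast
  qed
qed simp

text \<open>The situation forced by the count of flips: each new chord and each bridge is added
  exactly once, and nothing else is added.\<close>

locale tight_path =
  fixes r k :: nat and G :: "nat \<Rightarrow> chord set" and e f :: "nat \<Rightarrow> chord"
  assumes r: "r \<in> {2, 3}"
    and path: "flip_path r k G"
    and flip_step: "\<And>t. t < k \<Longrightarrow> e t \<in> G t \<and> f t \<notin> G t \<and> G (Suc t) = insert (f t) (G t - {e t})"
    and inj_f: "inj_on f {..<k}"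
    and image_f: "f ` {..<k} = set (new_chords r) \<union> bridge r ` {..<r}"
    and disjoint: "set (initial r) \<inter> (set (new_chords r) \<union> bridge r ` {..<r}) = {}"
      "set (final r) \<inter> bridge r ` {..<r} = {}"
begin

abbreviation bridges :: "chord set" where "bridges \<equiv> bridge r ` {..<r}"

lemma G_0: "G 0 = set (initial r)" and G_k: "G k = set (final r)"
  using path by (simp_all add: flip_path_def)

lemma entry: "s \<le> t \<Longrightarrow> t \<le> k \<Longrightarrow> h \<notin> G s \<Longrightarrow> h \<in> G t \<Longrightarrow> \<exists>u. s \<le> u \<and> u < t \<and> h = f u"
  by (rule first_entry[where G = G]) (use flip_step in auto)

lemma f_not_initial: "t < k \<Longrightarrow> f t \<notin> set (initial r)"
  using image_f disjoint(1) by blast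

text \<open>A returning chord is an added one, hence not initial. As it was present before it left,
  it was added earlier as well, contrary to the injectivity of \<open>f\<close>.\<close>

lemma no_return:
  assumes "s < t" "t \<le> k" "h \<in> G s" "h \<notin> G (Suc s)"
  shows "h \<notin> G t"
proof
  assume "h \<in> G t"
  then obtain u where u: "Suc s \<le> u" "u < t" "h = f u"
    using entry[of "Suc s" t h] assms by auto
  then have "h \<notin> G 0" using f_not_initial assms(2) by (simp add: G_0)
  then obtain u' where "u' < s" "h = f u'" using entry[of 0 s h] assms by auto
  then have "u = u'" using inj_f u assms(2) by (auto simp: inj_on_def)
  then show False using u \<open>u' < s\<close> by simp
qed

lemma stays:
  assumes "s \<le> t" "t \<le> u" "u \<le> k" "h \<in> G s" "h \<in> G u"
  shows "h \<in> G t"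
  using assms(1,2)
proof (induction t rule: dec_induct)
  case (step t)
  then show ?case using no_return[of t u h] assms(3,5) by fastforce
qed (use assms in simp)

lemma final_stays: "s \<le> t \<Longrightarrow> t \<le> k \<Longrightarrow> h \<in> G s \<Longrightarrow> h \<in> set (final r) \<Longrightarrow> h \<in> G t"
  using stays[of s t k h] by (simp add: G_k)

lemma bridges_exclusive:
  assumes "t \<le> k" "b \<in> G t" "b' \<in> G t" "b \<in> bridges" "b' \<in> bridges"
  shows "b = b'"
proof (rule ccontr)
  assume "b \<noteq> b'"
  obtain i j where ij: "i < r" "j < r" "b = bridge r i" "b' = bridge r j" using assms(4,5) by blast
  have "pairwise (\<lambda>e f. \<not> interleave e f) (G t)"
    using path assms(1) by (simp add: flip_path_def tree_def)
  then have "\<not> interleave b b'" "\<not> interleave b' b"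
    using \<open>b \<noteq> b'\<close> assms(2,3) pairwiseD by metis+
  then show False
    using bridges_interleave[of i j r] bridges_interleave[of j i r] ij \<open>b \<noteq> b'\<close>
    by (metis linorder_neqE_nat)
qed

lemma G_subset:
  assumes "t \<le> k"
  shows "G t \<subseteq> set (initial r) \<union> set (final r) \<union> bridges"
proof
  fix h assume h: "h \<in> G t"
  show "h \<in> set (initial r) \<union> set (final r) \<union> bridges"
  proof (cases "h \<in> G 0")
    case False
    then obtain u where "u < t" "h = f u" using entry[of 0 t h] h assms by auto
    then have "h \<in> f ` {..<k}" using assms by auto
    then show ?thesis unfolding image_f by (auto simp: final_def)
  qed (simp add: G_0)
qed

lemma idle_passage:
  assumes i: "i < r" and ab: "a \<le> b" "b \<le> k" and none: "\<And>t. a \<le> t \<Longrightarrow> t \<le> b \<Longrightarrow> bridge r i \<notin> G t"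
  shows "passage (b - a) (\<lambda>t. quot r i (G (a + t))) {}"
proof (rule quot_passage[OF path i ab])
  fix t assume t: "a \<le> t" "t \<le> b"
  show "quot r i (G t) \<subseteq> {} \<union> set (initial 1) \<union> set (final 1)"
  proof
    fix c assume "c \<in> quot r i (G t)"
    then obtain h where h: "h \<in> G t" "\<not> loop r i h" "c = collapse r i h" by (auto simp: quot_def)
    consider "h \<in> set (initial r) \<union> set (final r)" | j where "j < r" "h = bridge r j"
      using G_subset[of t] t ab h(1) by auto
    then show "c \<in> {} \<union> set (initial 1) \<union> set (final 1)"
    proof cases
      case 1
      then have "c \<in> quot r i (set (initial r)) \<union> quot r i (set (final r))"
        using h by (auto simp: quot_def)
      then show ?thesis using quot_initial_final[OF r i] by blast
    next
      case 2
      have "h \<noteq> bridge r i" using none[OF t] h(1) by blast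
      then have "c \<noteq> bridge 1 0"
        using collapse_bridge_iff[OF i, of h] bridge_in_chords[OF 2(1)] 2(2) h(3) by simp
      then show ?thesis using not_foreign_bridge[OF i 2(1)] 2(2) h by (auto simp: foreign_def)
    qed
  qed
qed

end

text \<open>The chords available when the boxes in \<open>S\<close> are finished and the others
  untouched. A nonempty \<open>S\<close> excludes \<open>(0, 5 * r + 1)\<close> and a proper one
  excludes \<open>(4 * r, 9 * r + 1)\<close>; the remaining chords are one too few for a
  tree.\<close>

definition mixed_chords :: "nat \<Rightarrow> nat list \<Rightarrow> chord list" where
  "mixed_chords r S = filter (\<lambda>h. list_all (\<lambda>i. loop r i h \<or>
     collapse r i h \<in> set (if i \<in> set S then final 1 else initial 1)) [0..<r])
     (initial r @ new_chords r)"

lemma length_mixed_chords: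
  "list_all (\<lambda>S. length (mixed_chords 2 S) \<le> 20) [[0], [1]]"
  "list_all (\<lambda>S. length (mixed_chords 3 S) \<le> 30) [[0], [1], [2], [0, 1], [0, 2], [1, 2]]"
  by code_simp+

lemma mixed_chords_bound:
  assumes "r \<in> {2, 3}" "S \<subseteq> {..<r}" "S \<noteq> {}" "S \<noteq> {..<r}"
  shows "\<exists>xs. set xs = S \<and> length (mixed_chords r xs) \<le> 10 * r"
proof -
  define xs where "xs = filter (\<lambda>i. i \<in> S) [0..<r]"
  have set: "set xs = S" using assms(2) by (auto simp: xs_def)
  have ne: "xs \<noteq> []" "xs \<noteq> [0..<r]" using set assms(3,4) by auto
  have "r = 2 \<or> r = 3" using assms(1) by auto
  then have "length (mixed_chords r xs) \<le> 10 * r"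
  proof
    assume r: "r = 2"
    have "[0..<r] = [0, 1]" by (simp add: r upt_rec)
    then have "xs \<in> set [[0], [1]]"
      using ne unfolding xs_def by (simp split: if_splits)
    from bspec[OF length_mixed_chords(1)[unfolded list_all_iff] this] show ?thesis
      by (simp add: r)
  next
    assume r: "r = 3"
    have "[0..<r] = [0, 1, 2]" by (simp add: r upt_rec)
    then have "xs \<in> set [[0], [1], [2], [0, 1], [0, 2], [1, 2]]"
      using ne unfolding xs_def by (simp split: if_splits)
    from bspec[OF length_mixed_chords(2)[unfolded list_all_iff] this] show ?thesis
      by (simp add: r)
  qed
  with set show ?thesis by blast
qed

context tight_path
begin

lemma bridge_added: "i < r \<Longrightarrow> \<exists>u<k. f u = bridge r i"
  using image_f by (metis (no_types, lifting) UnI2 imageE imageI lessThan_iff)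

lemma bridge_not_initial: "i < r \<Longrightarrow> bridge r i \<notin> G 0"
  using disjoint(1) by (auto simp: G_0)

text \<open>
  Were no bridge present between the additions of two bridges, each box would be either untouched
  or finished at that moment, and the tree would have too few chords.
\<close>
lemma no_gap:
  assumes t: "t \<le> k" and none: "G t \<inter> bridges = {}"
    and before: "s < t" "f s \<in> bridges" and after: "t \<le> u" "u < k" "f u \<in> bridges"
  shows False
proof -
  define S where "S = {i. i < r \<and> (\<exists>u<t. f u = bridge r i)}"
  have "S \<subseteq> {..<r}" by (auto simp: S_def)
  moreover have "S \<noteq> {}" using before by (auto simp: S_def)
  moreover have "S \<noteq> {..<r}"
  proof
    assume "S = {..<r}"
    obtain i where i: "i < r" "f u = bridge r i" using after(3) by blast
    then have "i \<in> S" using \<open>S = {..<r}\<close> by simp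
    then obtain u' where "u' < t" "f u' = bridge r i" by (auto simp: S_def)
    then show False using inj_onD[OF inj_f, of u' u] i after(1,2) t by auto
  qed
  ultimately obtain xs where xs: "set xs = S" "length (mixed_chords r xs) \<le> 10 * r"
    using mixed_chords_bound[OF r] by blast
  \<comment> \<open>The bridge of a box in \<open>S\<close> does not occur from \<open>t\<close> on,
    so the idle passage is read backwards from the final tree. For any other box it has not occurred
    yet, and the passage is read forwards from the initial tree.\<close>
  have Q: "quot r i (G t) \<subseteq> set (if i \<in> S then final 1 else initial 1)" if i: "i < r" for i
  proof (cases "i \<in> S")
    case True
    then obtain u where u: "u < t" "f u = bridge r i" by (auto simp: S_def)
    have "bridge r i \<notin> G v" if v: "t \<le> v" "v \<le> k" for v
    proof
      assume "bridge r i \<in> G v"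
      then obtain u' where "t \<le> u'" "u' < v" "f u' = bridge r i"
        using entry[of t v "bridge r i"] none v i by fastforce
      then show False using inj_onD[OF inj_f, of u u'] u v by auto
    qed
    from idle_passage[OF i t le_refl this]
    have P: "passage (k - t) (\<lambda>s. quot r i (G (t + (k - t - s)))) {}"
      using passage_reverse by fastforce
    have "quot r i (G (t + (k - t - (k - t)))) \<subseteq> set (final 1)"
      by (rule passage_idle(2)[OF P]) (use t quot_initial_final[OF r i] in \<open>simp_all add: G_k\<close>)
    then show ?thesis using True by simp
  next
    case False
    have "bridge r i \<notin> G v" if v: "v \<le> t" for v
    proof
      assume "bridge r i \<in> G v"
      then obtain u' where "u' < v" "f u' = bridge r i"
        using entry[of 0 v "bridge r i"] bridge_not_initial[OF i] v t by fastforce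
      then show False using False i v by (auto simp: S_def)
    qed
    then have "passage (t - 0) (\<lambda>s. quot r i (G (0 + s))) {}"
      by (intro idle_passage[OF i _ t]) auto
    then have P: "passage t (\<lambda>s. quot r i (G s)) {}" by simp
    have "quot r i (G t) \<subseteq> set (initial 1)"
      by (rule passage_idle(1)[OF P]) (use quot_initial_final[OF r i] in \<open>simp_all add: G_0\<close>)
    then show ?thesis using False by simp
  qed
  have "G t \<subseteq> set (mixed_chords r xs)"
  proof
    fix h assume h: "h \<in> G t"
    then have "h \<in> set (initial r @ new_chords r)"
      using G_subset[OF t] none by (auto simp: initial_def final_def)
    moreover have "loop r i h \<or> collapse r i h \<in> set (if i \<in> set xs then final 1 else initial 1)"
      if "i < r" for i
      using Q[OF that] h by (auto simp: quot_def xs(1))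
    ultimately show "h \<in> set (mixed_chords r xs)"
      by (auto simp: mixed_chords_def list_all_iff)
  qed
  then have "card (G t) \<le> length (mixed_chords r xs)"
    by (meson List.finite_set card_length card_mono le_trans)
  moreover have "card (G t) + 1 = 10 * r + 2" using path t by (simp add: flip_path_def tree_def)
  ultimately show False using xs(2) by simp
qed

text \<open>
  \<open>L h t\<close> stands for the number of entries of the trace of \<open>h\<close> in the sequence that starts at its
  \<open>t\<close>-th tree.
\<close>

lemma length_trace:
  fixes L :: "chord \<Rightarrow> nat \<Rightarrow> nat"
  assumes keep: "\<And>h t. t < k \<Longrightarrow> h \<in> chords (10 * r + 2) \<Longrightarrow> h \<in> G (Suc t) \<Longrightarrow> L h t = L h (Suc t)"
    and move: "\<And>h t. t < k \<Longrightarrow> h \<in> chords (10 * r + 2) \<Longrightarrow> h \<notin> G (Suc t) \<Longrightarrow> L h t = Suc (L (f t) (Suc t))"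
    and stop: "\<And>h. L h k = 1"
  shows "\<exists>h\<in>set (initial r). L h 0 = r + 2"
proof -
  have chord: "h \<in> chords (10 * r + 2)" if "h \<in> G t" "t \<le> k" for h t
    using flip_path_chords[OF path that(2)] that(1) by blast
  have at_final: "L h t = 1" if "t \<le> k" "h \<in> set (final r)" "h \<in> G t" for h t
    using that(1,3)
  proof (induction t rule: inc_induct)
    case (step t)
    then have "h \<in> G (Suc t)" using final_stays[of t "Suc t" h] that(2) by simp
    then show ?case using keep[of t h] chord[of h t] step by simp
  qed (rule stop)
  define c where "c t = card {u. t \<le> u \<and> u < k \<and> f u \<in> bridges}" for t
  have c_Suc: "c t = (if f t \<in> bridges then Suc (c (Suc t)) else c (Suc t))" if "t < k" for t
  proof -
    have "{u. t \<le> u \<and> u < k \<and> f u \<in> bridges} =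
      (if f t \<in> bridges then insert t else id) {u. Suc t \<le> u \<and> u < k \<and> f u \<in> bridges}"
      using that by (auto simp: le_eq_less_or_eq Suc_le_eq)
    then show ?thesis by (simp add: c_def)
  qed
  \<comment> \<open>The trace of a bridge consists of the bridge itself, the \<open>c t\<close>
    bridges still to be added and one last chord of the final tree.\<close>
  have at_bridge: "L b t = c t + 2" if "t \<le> k" "b \<in> bridges" "b \<in> G t" for b t
    using that
  proof (induction t arbitrary: b rule: inc_induct)
    case base
    then show ?case using disjoint(2) by (auto simp: G_k)
  next
    case (step t)
    note IH = step.IH
    have t: "t < k" "t \<le> k" using step.hyps by simp_all
    have b: "b \<in> bridges" "b \<in> G t" "b \<in> chords (10 * r + 2)"
      using step.prems chord t(2) by simp_all
    show ?case
    proof (cases "b \<in> G (Suc t)")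
      case True
      have "f t \<notin> bridges"
        using bridges_exclusive[of "Suc t" b "f t"] True b flip_step[OF t(1)] t by auto
      then show ?thesis using keep[OF t(1) b(3) True] IH[OF b(1) True] c_Suc[OF t(1)] by simp
    next
      case False
      show ?thesis
      proof (cases "f t \<in> bridges")
        case True
        have "f t \<in> G (Suc t)" using flip_step[OF t(1)] by simp
        then show ?thesis
          using move[OF t(1) b(3) False] IH[OF True] c_Suc[OF t(1)] True by simp
      next
        case no: False
        have ft: "f t \<in> G (Suc t)" using flip_step[OF t(1)] by simp
        have "f t \<in> f ` {..<k}" using t by simp
        then have "f t \<in> set (final r)" using no unfolding image_f by (simp add: final_def)
        then have "L (f t) (Suc t) = 1" using at_final ft t by simp
        \<comment> \<open>The bridge \<open>b\<close> was added before; were another one still to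
          come, the tree after this flip would be a gap without bridges.\<close>
        moreover have "c (Suc t) = 0"
        proof (rule ccontr)
          assume "c (Suc t) \<noteq> 0"
          then obtain u where u: "Suc t \<le> u" "u < k" "f u \<in> bridges"
            unfolding c_def by (metis (mono_tags, lifting) card.empty empty_Collect_eq)
          have "b \<notin> G 0" using disjoint(1) b(1) by (auto simp: G_0)
          then obtain s where s: "s < t" "f s = b" using entry[of 0 t b] b t by auto
          have "G (Suc t) \<inter> bridges = {}"
          proof (rule equals0I)
            fix x assume x: "x \<in> G (Suc t) \<inter> bridges"
            then have "x \<in> G t" using flip_step[OF t(1)] no by auto
            then have "x = b" using bridges_exclusive[OF t(2)] x b by blast
            then show False using x False by blast
          qed
          then show False using no_gap[of "Suc t" s u] s u b(1) t by simp
        qed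
        ultimately show ?thesis
          using move[OF t(1) b(3) False] c_Suc[OF t(1)] no by simp
      qed
    qed
  qed
  have "c 0 = r"
  proof -
    let ?U = "{u. 0 \<le> u \<and> u < k \<and> f u \<in> bridges}"
    have "f ` ?U = bridges"
    proof
      show "bridges \<subseteq> f ` ?U"
      proof
        fix x assume x: "x \<in> bridges"
        then have "x \<in> f ` {..<k}" unfolding image_f by blast
        then show "x \<in> f ` ?U" using x by blast
      qed
    qed blast
    moreover have "inj_on f ?U" by (rule inj_on_subset[OF inj_f]) auto
    ultimately have "c 0 = card bridges" using card_image[of f ?U] by (simp add: c_def)
    also have "\<dots> = r" using bridge_inj by (subst card_image) (auto simp: inj_on_def)
    finally show ?thesis .
  qed
  have "0 < r" using r by auto
  then have ex: "\<exists>u. u < k \<and> f u \<in> bridges" using bridge_added[of 0] by blast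
  \<comment> \<open>At the first flip that adds a bridge, the removed edge is initial, because the
    chords added before belong to the final tree and stay. This edge has the long trace.\<close>
  define t where "t = (LEAST u. u < k \<and> f u \<in> bridges)"
  have t: "t < k" "f t \<in> bridges" using LeastI_ex[OF ex] by (simp_all add: t_def)
  have least: "f u \<notin> bridges" if "u < t" for u
    using not_less_Least[of u "\<lambda>u. u < k \<and> f u \<in> bridges"] that t by (auto simp: t_def)
  have et: "e t \<in> G t" "e t \<notin> G (Suc t)" using flip_step[OF t(1)] by auto
  have e0: "e t \<in> G 0"
  proof (rule ccontr)
    assume "e t \<notin> G 0"
    then obtain u where u: "u < t" "e t = f u" using entry[of 0 t "e t"] et t by auto
    then have "e t \<in> f ` {..<k}" "e t \<notin> bridges" using t least by auto
    then have "e t \<in> set (final r)" unfolding image_f by (simp add: final_def)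
    then have "e t \<in> G (Suc t)" using final_stays[of t "Suc t" "e t"] et t by simp
    then show False using et by blast
  qed
  have "L (e t) 0 = L (e t) s" if "s \<le> t" for s
    using that
  proof (induction s)
    case (Suc s)
    have "e t \<in> G (Suc s)" using stays[of 0 "Suc s" t "e t"] Suc.prems t e0 et by simp
    then show ?case using Suc keep[of s "e t"] chord[OF e0] t by simp
  qed simp
  from this[of t] have "L (e t) 0 = Suc (L (f t) (Suc t))"
    using move[OF t(1) _ et(2)] chord[OF e0] by simp
  also have "L (f t) (Suc t) = c (Suc t) + 2"
    using at_bridge[of "Suc t" "f t"] t flip_step[OF t(1)] by simp
  also have "Suc (c (Suc t)) = r"
  proof -
    have "c s = c 0" if "s \<le> t" for s
      using that by (induction s) (use c_Suc least t in auto)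
    then show ?thesis using c_Suc[OF t(1)] t(2) \<open>c 0 = r\<close> by simp
  qed
  then have "Suc (c (Suc t) + 2) = r + 2" by simp
  finally show ?thesis using e0 by (auto simp: G_0)
qed

end

lemma instance_chords:
  assumes "r \<in> {2, 3}"
  shows "card (set (new_chords r)) = 6 * r + 1" "set (initial r) \<inter> set (new_chords r) = {}"
    "(set (initial r) \<union> set (final r)) \<inter> bridge r ` {..<r} = {}"
proof -
  have "list_all (\<lambda>r. distinct (new_chords r) \<and> length (new_chords r) = 6 * r + 1 \<and>
      (\<forall>h\<in>set (new_chords r). h \<notin> set (initial r)) \<and>
      (\<forall>i\<in>set [0..<r]. bridge r i \<notin> set (initial r) \<and> bridge r i \<notin> set (final r))) [2, 3]"
    by code_simp
  from bspec[OF this[unfolded list_all_iff], of r]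
  have *: "distinct (new_chords r) \<and> length (new_chords r) = 6 * r + 1 \<and>
      (\<forall>h\<in>set (new_chords r). h \<notin> set (initial r)) \<and>
      (\<forall>i\<in>set [0..<r]. bridge r i \<notin> set (initial r) \<and> bridge r i \<notin> set (final r))"
    using assms by simp
  then show "card (set (new_chords r)) = 6 * r + 1" using distinct_card by metis
  show "set (initial r) \<inter> set (new_chords r) = {}" using * by blast
  show "(set (initial r) \<union> set (final r)) \<inter> bridge r ` {..<r} = {}" using * by auto
qed

text \<open>Every chord that is not initial must be added by some flip. The \<open>6 * r + 1\<close>
  new chords leave at most \<open>r\<close> flips for outside chords, which are therefore the
  bridges; equality in the count makes \<open>f\<close> injective.\<close>

lemma tight_path_exists:
  assumes r: "r \<in> {2, 3}" and G: "flip_path r k G" and k: "k \<le> 7 * r + 1"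
  shows "\<exists>e f. tight_path r k G e f"
proof -
  have "\<forall>t. \<exists>e f. t < k \<longrightarrow> e \<in> G t \<and> f \<notin> G t \<and> G (Suc t) = insert f (G t - {e})"
    using G unfolding flip_path_def by blast
  then obtain e f where ef: "\<And>t. t < k \<Longrightarrow> e t \<in> G t \<and> f t \<notin> G t \<and> G (Suc t) = insert (f t) (G t - {e t})"
    by metis
  let ?D = "(\<Union>t\<le>k. G t) - set (initial r)"
  have ends: "G 0 = set (initial r)" "G k = set (final r)" using G by (simp_all add: flip_path_def)
  have D_sub: "?D \<subseteq> f ` {..<k}"
  proof
    fix h assume "h \<in> ?D"
    then obtain t where "t \<le> k" "h \<in> G t" "h \<notin> G 0" using ends by auto
    then obtain u where "u < t" "h = f u"
      using first_entry[of k G f 0 t h] ef by auto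
    then show "h \<in> f ` {..<k}" using \<open>t \<le> k\<close> by auto
  qed
  have "set (new_chords r) \<subseteq> G k" by (auto simp: ends final_def)
  then have D: "?D = set (new_chords r) \<union> outside r k G"
    using instance_chords(2)[OF r] by (auto simp: outside_def final_def initial_def)
  have out_new: "set (new_chords r) \<inter> outside r k G = {}"
    by (auto simp: outside_def final_def)
  have cardD: "card ?D = 6 * r + 1 + card (outside r k G)"
    unfolding D using out_new finite_outside[OF G] instance_chords(1)[OF r]
    by (subst card_Un_disjoint) auto
  have "card ?D \<le> card (f ` {..<k})" using D_sub by (intro card_mono) auto
  also have card_f: "card (f ` {..<k}) \<le> k" using card_image_le[of "{..<k}" f] by simp
  finally have "card (outside r k G) \<le> r" using cardD k by simp
  then have out: "outside r k G = bridge r ` {..<r}" by (rule outside_eq_bridges[OF r G])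
  have "card (bridge r ` {..<r}) = r" using bridge_inj by (subst card_image) (auto simp: inj_on_def)
  then have "k \<le> card ?D" using cardD k out by simp
  then have "?D = f ` {..<k}" using D_sub card_f by (intro card_seteq) auto
  moreover from this have "card (f ` {..<k}) = card {..<k}" using card_f \<open>k \<le> card ?D\<close> by simp
  then have "inj_on f {..<k}" by (intro eq_card_imp_inj_on) auto
  ultimately have "tight_path r k G e f"
    using instance_chords[OF r] out D ef
    by (unfold_locales) (use r G in auto)
  then show ?thesis by blast
qed

section \<open>An explicit flip sequence\<close>

primrec playable :: "nat \<Rightarrow> chord list \<Rightarrow> (chord \<times> chord) list \<Rightarrow> bool" where
  "playable n T [] = True"
| "playable n T (m # ms) = (case m of (e, f) \<Rightarrow>
     e \<in> set T \<and> f \<notin> set T \<and> fst f < snd f \<and> snd f < n \<and>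
     (\<forall>g\<in>set (remove1 e T). \<not> interleave f g) \<and> Suc (merges (f # remove1 e T)) = n \<and>
     playable n (f # remove1 e T) ms)"

primrec play :: "chord list \<Rightarrow> (chord \<times> chord) list \<Rightarrow> chord list list" where
  "play T [] = [T]"
| "play T (m # ms) = T # play (snd m # remove1 (fst m) T) ms"

text \<open>With seven flips per box and one last flip this attains the bound of
  \<open>tight_path_exists\<close>.\<close>

definition moves :: "nat \<Rightarrow> (chord \<times> chord) list" where
  "moves r = concat (map (\<lambda>i.
      (if i = 0 then (0, 5 * r + 1) else bridge r (i - 1), bridge r i) # zip (old_box r i) (new_box r i))
      [0..<r]) @ [(bridge r (r - 1), (4 * r, 9 * r + 1))]"

lemma hd_play: "hd (play T ms) = T"
  by (cases ms) auto

lemma length_play: "length (play T ms) = Suc (length ms)"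
  by (induction ms arbitrary: T) auto

lemma linked_list_iff:
  assumes "set T \<subseteq> chords n" "0 < n"
  shows "linked {..<n} (set T) \<longleftrightarrow> Suc (merges T) = n"
proof -
  have "set T \<subseteq> {..<n} \<times> {..<n}" using assms(1) by (auto simp: chords_def)
  then show ?thesis using linked_iff_merges[of "{..<n}" T] assms(2) by (auto simp: lessThan_empty_iff)
qed

lemma play_trees:
  assumes "playable n T ms" "tree n (set T)" "distinct T"
  shows "(\<forall>T'\<in>set (play T ms). tree n (set T')) \<and>
    successively (flip (pt ` {..<n})) (map (\<lambda>T. seg ` set T) (play T ms))"
  using assms
proof (induction ms arbitrary: T)
  case (Cons m ms)
  obtain e f where m: "m = (e, f)" by (cases m)
  let ?T = "f # remove1 e T"
  have ok: "e \<in> set T" "f \<notin> set T" "f \<in> chords n" "\<forall>g\<in>set (remove1 e T). \<not> interleave f g"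
    "Suc (merges ?T) = n" "playable n ?T ms"
    using Cons.prems(1) by (auto simp: m chords_def)
  have T: "set T \<subseteq> chords n" "card (set T) + 1 = n" "pairwise (\<lambda>e f. \<not> interleave e f) (set T)"
    using Cons.prems(2) by (auto simp: tree_def)
  have set_T': "set ?T = insert f (set T - {e})" using Cons.prems(3) by simp
  have dist: "distinct ?T" using Cons.prems(3) ok(2) by simp
  have "tree n (set ?T)"
    unfolding tree_def
  proof (intro conjI)
    show sub: "set ?T \<subseteq> chords n" using T(1) ok(3) set_T' by auto
    show "linked {..<n} (set ?T)" using linked_list_iff[OF sub] ok(5) by simp
    have "card (set ?T) = Suc (card (set T - {e}))"
      unfolding set_T' using ok(2) by (subst card_insert_disjoint) auto
    also have "\<dots> = card (set T)" using ok(1) by (intro card_Suc_Diff1) auto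
    finally have "card (set ?T) = card (set T)" .
    then show "card (set ?T) + 1 = n" using T(2) by simp
    have "pairwise (\<lambda>e f. \<not> interleave e f) (set T - {e})" using T(3) by (rule pairwise_subset) auto
    then show "pairwise (\<lambda>e f. \<not> interleave e f) (set ?T)"
      using ok(4) Cons.prems(3) interleave_commute unfolding set_T' pairwise_insert by auto
  qed
  note IH = Cons.IH[OF ok(6) this dist]
  have "flip (pt ` {..<n}) (seg ` set T) (seg ` set ?T)"
    unfolding flip_def
  proof (intro conjI exI)
    show "plane_spanning_tree (pt ` {..<n}) (seg ` set T)"
      using plane_spanning_tree_seg_iff[OF T(1)] Cons.prems(2) by simp
    show "plane_spanning_tree (pt ` {..<n}) (seg ` set ?T)"
      using plane_spanning_tree_seg_iff[of "set ?T" n] \<open>tree n (set ?T)\<close> by (simp add: tree_def)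
    show "seg e \<in> seg ` set T" using ok(1) by blast
    have *: "seg f = seg g \<longleftrightarrow> f = g" "seg e = seg g \<longleftrightarrow> e = g" if "g \<in> set T" for g
      using that T(1) ok(1,3) seg_eq_iff by blast+
    show "seg f \<notin> seg ` set T" using *(1) ok(2) by blast
    show "seg ` set ?T = insert (seg f) (seg ` set T - {seg e})"
      unfolding set_T' using *(2) by blast
  qed
  then show ?case using IH Cons.prems(2) by (simp add: m successively_Cons hd_play hd_map
      length_play flip: length_0_conv)
qed simp

lemma playable_moves:
  "playable 22 (initial 2) (moves 2)" "playable 32 (initial 3) (moves 3)"
  by code_simp+

lemma moves_final:
  "list_all (\<lambda>r. length (moves r) = 7 * r + 1 \<and> (let T = last (play (initial r) (moves r)) in
     (\<forall>e\<in>set T. e \<in> set (final r)) \<and> (\<forall>e\<in>set (final r). e \<in> set T))) [2, 3]"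
  by code_simp

lemma initial_tree:
  "list_all (\<lambda>r. distinct (initial r) \<and> length (initial r) = 10 * r + 1 \<and>
     list_all (\<lambda>(i, j). i < j \<and> j < 10 * r + 2) (initial r) \<and>
     list_all (\<lambda>e. list_all (\<lambda>f. \<not> interleave e f) (initial r)) (initial r) \<and>
     Suc (merges (initial r)) = 10 * r + 2) [2, 3]"
  by code_simp

lemma tree_initial:
  assumes "r \<in> {2, 3}"
  shows "tree (10 * r + 2) (set (initial r))" "distinct (initial r)"
proof -
  have *: "distinct (initial r) \<and> length (initial r) = 10 * r + 1 \<and>
     (\<forall>(i, j)\<in>set (initial r). i < j \<and> j < 10 * r + 2) \<and>
     (\<forall>e\<in>set (initial r). \<forall>f\<in>set (initial r). \<not> interleave e f) \<and>
     Suc (merges (initial r)) = 10 * r + 2"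
    using bspec[OF initial_tree[unfolded list_all_iff], of r] assms by simp
  then show "distinct (initial r)" by blast
  have sub: "set (initial r) \<subseteq> chords (10 * r + 2)" using * by (auto simp: chords_def)
  have "pairwise (\<lambda>e f. \<not> interleave e f) (set (initial r))" using * by (simp add: pairwise_def)
  moreover have "card (set (initial r)) = 10 * r + 1" using * distinct_card by metis
  ultimately show "tree (10 * r + 2) (set (initial r))"
    using linked_list_iff[OF sub] * sub by (simp add: tree_def)
qed

lemma moves_trees:
  assumes "r \<in> {2, 3}"
  defines "p \<equiv> play (initial r) (moves r)"
  shows "\<And>T. T \<in> set p \<Longrightarrow> tree (10 * r + 2) (set T)"
    and "successively (flip (pt ` {..<10 * r + 2})) (map (\<lambda>T. seg ` set T) p)"
    and "length p = 7 * r + 2" "set (last p) = set (final r)"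
proof -
  have "playable (10 * r + 2) (initial r) (moves r)" using playable_moves assms(1) by auto
  note * = play_trees[OF this tree_initial[OF assms(1)]]
  show "\<And>T. T \<in> set p \<Longrightarrow> tree (10 * r + 2) (set T)"
    and "successively (flip (pt ` {..<10 * r + 2})) (map (\<lambda>T. seg ` set T) p)"
    using * unfolding p_def by blast+
  show "length p = 7 * r + 2" "set (last p) = set (final r)"
    using moves_final assms(1) unfolding list_all_iff Let_def p_def by (auto simp: length_play)
qed

lemma tree_final:
  assumes "r \<in> {2, 3}"
  shows "tree (10 * r + 2) (set (final r))"
proof -
  let ?p = "play (initial r) (moves r)"
  have "?p \<noteq> []" using moves_trees(3)[OF assms] by auto
  then show ?thesis using moves_trees(1)[OF assms last_in_set] moves_trees(4)[OF assms] by simp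
qed

lemma short_flip_sequence:
  assumes "r \<in> {2, 3}"
  shows "\<exists>Ts. flip_sequence (pt ` {..<10 * r + 2}) (seg ` set (initial r)) (seg ` set (final r)) Ts \<and>
    flip_count Ts = 7 * r + 1"
proof -
  let ?p = "play (initial r) (moves r)"
  let ?Ts = "map (\<lambda>T. seg ` set T) ?p"
  have ne: "?p \<noteq> []" using moves_trees(3)[OF assms] by auto
  have "flip_sequence (pt ` {..<10 * r + 2}) (seg ` set (initial r)) (seg ` set (final r)) ?Ts"
    unfolding flip_sequence_def
  proof (intro conjI ballI)
    show "?Ts \<noteq> []" using ne by simp
    show "hd ?Ts = seg ` set (initial r)" using ne by (simp add: hd_map hd_play)
    show "last ?Ts = seg ` set (final r)" using ne moves_trees(4)[OF assms] by (simp add: last_map)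
    show "successively (flip (pt ` {..<10 * r + 2})) ?Ts" by (rule moves_trees(2)[OF assms])
    fix T assume "T \<in> set ?Ts"
    then obtain T' where T': "T' \<in> set ?p" "T = seg ` set T'" by auto
    have "tree (10 * r + 2) (set T')" by (rule moves_trees(1)[OF assms T'(1)])
    then show "plane_spanning_tree (pt ` {..<10 * r + 2}) T"
      using plane_spanning_tree_seg_iff[of "set T'"] T'(2) by (simp add: tree_def)
  qed
  moreover have "flip_count ?Ts = 7 * r + 1"
    using moves_trees(3)[OF assms] by (simp add: flip_count_def)
  ultimately show ?thesis by blast
qed

section \<open>Transfer to geometric flip sequences\<close>

lemma trace_Cons:
  "trace h (A # B # Ts) = (if h \<in> B then trace h (B # Ts) else h # trace (the_elem (B - A)) (B # Ts))"
  by simp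

text \<open>A shortest sequence is no longer than the explicit one, so its chord version is a tight
  path. Traces in the suffixes of the sequence play the role of \<open>L\<close> in
  \<open>length_trace\<close>.\<close>

lemma long_trace:
  assumes r: "r \<in> {2, 3}"
    and short: "shortest_flip_sequence (pt ` {..<10 * r + 2}) (seg ` set (initial r)) (seg ` set (final r)) Ts"
  shows "\<exists>h\<in>seg ` set (initial r). trace_length h Ts = r + 1"
proof -
  define n where "n = 10 * r + 2"
  define k where "k = flip_count Ts"
  define G where "G t = chords_of n (Ts ! t)" for t
  have seq: "flip_sequence (pt ` {..<n}) (seg ` set (initial r)) (seg ` set (final r)) Ts"
    using short by (simp add: shortest_flip_sequence_def n_def)
  have k: "k \<le> 7 * r + 1"
    using short_flip_sequence[OF r] short unfolding shortest_flip_sequence_def k_def by metis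
  have ne: "Ts \<noteq> []" using seq by (simp add: flip_sequence_def)
  then have len: "length Ts = Suc k" by (simp add: k_def flip_count_def)
  have plane: "plane_spanning_tree (pt ` {..<n}) (Ts ! t)" if "t \<le> k" for t
    using seq that len nth_mem[of t Ts] by (simp add: flip_sequence_def)
  have tree: "tree n (G t)" and seg_G: "seg ` G t = Ts ! t" if "t \<le> k" for t
    using tree_chords_of[OF plane[OF that]] by (simp_all add: G_def)
  have chords: "G t \<subseteq> chords n" for t by (auto simp: G_def chords_of_def)
  have mem: "seg h \<in> Ts ! t \<longleftrightarrow> h \<in> G t" if "h \<in> chords n" for h t
    using that by (simp add: G_def chords_of_def)
  have ends: "Ts ! 0 = seg ` set (initial r)" "Ts ! k = seg ` set (final r)"
    using seq ne len by (simp_all add: flip_sequence_def hd_conv_nth last_conv_nth)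
  have init_chords: "set (initial r) \<subseteq> chords n"
    using tree_initial[OF r] by (simp add: tree_def n_def)
  have final_chords: "set (final r) \<subseteq> chords n"
    using tree_final[OF r] by (simp add: tree_def n_def)
  have "flip_path r k G"
    unfolding flip_path_def
  proof (intro conjI allI impI)
    show "G 0 = set (initial r)" using chords_of_seg[OF init_chords] by (simp add: G_def ends)
    show "G k = set (final r)" using chords_of_seg[OF final_chords] by (simp add: G_def ends)
    show "tree (10 * r + 2) (G t)" if "t \<le> k" for t using tree[OF that] by (simp add: n_def)
    fix t assume t: "t < k"
    then have "flip (pt ` {..<n}) (Ts ! t) (Ts ! Suc t)"
      using seq len by (simp add: flip_sequence_def successively_conv_nth)
    then obtain a b where ab: "a \<in> Ts ! t" "b \<notin> Ts ! t" "Ts ! Suc t = insert b (Ts ! t - {a})"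
      unfolding flip_def by blast
    have "a \<in> seg ` G t" using ab(1) seg_G[of t] t by simp
    then obtain e where e: "e \<in> G t" "a = seg e" by blast
    have "b \<in> seg ` G (Suc t)" using ab(3) seg_G[of "Suc t"] t by simp
    then obtain f where f: "f \<in> G (Suc t)" "b = seg f" by blast
    have cf: "f \<in> chords n" "e \<in> chords n" using chords e f by blast+
    have "h \<in> G (Suc t) \<longleftrightarrow> h \<in> insert f (G t - {e})" if h: "h \<in> chords n" for h
      using mem[OF h, of t] mem[OF h, of "Suc t"] ab(3) e(2) f(2)
        seg_eq_iff[OF h cf(1)] seg_eq_iff[OF h cf(2)] by auto
    then have "G (Suc t) = insert f (G t - {e})" using chords[of "Suc t"] chords[of t] cf by blast
    moreover have "f \<notin> G t" using mem[OF cf(1)] ab(2) f(2) by simp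
    ultimately show "\<exists>e f. e \<in> G t \<and> f \<notin> G t \<and> G (Suc t) = insert f (G t - {e})"
      using e(1) by blast
  qed
  then obtain e f where "tight_path r k G e f" using tight_path_exists[OF r _ k] by blast
  then interpret tight_path r k G e f .
  define L where "L h t = length (trace (seg h) (drop t Ts))" for h t
  have drop: "drop t Ts = Ts ! t # Ts ! Suc t # drop (Suc (Suc t)) Ts"
    "drop (Suc t) Ts = Ts ! Suc t # drop (Suc (Suc t)) Ts" if "t < k" for t
    using that len by (simp_all add: Cons_nth_drop_Suc)
  have "\<exists>h\<in>set (initial r). L h 0 = r + 2"
  proof (rule length_trace)
    fix h t assume t: "t < k" and h: "h \<in> chords (10 * r + 2)"
    have h_iff: "seg h \<in> Ts ! Suc t \<longleftrightarrow> h \<in> G (Suc t)" using mem h by (simp add: n_def)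
    show "L h t = L h (Suc t)" if "h \<in> G (Suc t)"
      unfolding L_def drop[OF t] trace_Cons using that h_iff by simp
    show "L h t = Suc (L (f t) (Suc t))" if "h \<notin> G (Suc t)"
    proof -
      have "Ts ! Suc t - Ts ! t = seg ` G (Suc t) - seg ` G t" using seg_G t by simp
      also have "\<dots> = seg ` (G (Suc t) - G t)"
      proof (rule inj_on_image_set_diff[symmetric])
        show "inj_on seg (chords n)" by (rule inj_seg[OF subset_refl])
        show "G (Suc t) - G t \<subseteq> chords n" using chords[of "Suc t"] by blast
        show "G t \<subseteq> chords n" by (rule chords)
      qed
      also have "G (Suc t) - G t = {f t}" using flip_step[OF t] by auto
      finally have "the_elem (Ts ! Suc t - Ts ! t) = seg (f t)" by simp
      then show ?thesis unfolding L_def drop[OF t] trace_Cons using that h_iff by simp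
    qed
  next
    show "L h k = 1" for h
    proof -
      have "drop k Ts = [Ts ! k]" using len by (simp flip: Cons_nth_drop_Suc)
      then show ?thesis by (simp add: L_def)
    qed
  qed
  then obtain h where h: "h \<in> set (initial r)" "L h 0 = r + 2" by blast
  then have "trace_length (seg h) Ts = r + 1" by (simp add: L_def trace_length_def)
  then show ?thesis using h(1) by blast
qed

lemma plane_spanning_trees:
  assumes "r \<in> {2, 3}"
  shows "plane_spanning_tree (pt ` {..<10 * r + 2}) (seg ` set (initial r))"
    "plane_spanning_tree (pt ` {..<10 * r + 2}) (seg ` set (final r))"
  using tree_initial(1)[OF assms] tree_final[OF assms]
    plane_spanning_tree_seg_iff[of "set (initial r)"] plane_spanning_tree_seg_iff[of "set (final r)"]
  by (simp_all add: tree_def)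

lemma forced_trace:
  assumes "r \<in> {2, 3}"
  shows "\<exists>P T\<^sub>I T\<^sub>F. convex_position P \<and> card P = 10 * r + 2 \<and>
    plane_spanning_tree P T\<^sub>I \<and> plane_spanning_tree P T\<^sub>F \<and>
    (\<forall>Ts. shortest_flip_sequence P T\<^sub>I T\<^sub>F Ts \<longrightarrow> (\<exists>e\<in>T\<^sub>I. trace_length e Ts = r + 1))"
proof (intro exI conjI allI impI)
  show "convex_position (pt ` {..<10 * r + 2})" by (rule convex_position_pt)
  show "card (pt ` {..<10 * r + 2}) = 10 * r + 2" using inj_pt by (simp add: card_image)
qed (use plane_spanning_trees[OF assms] long_trace[OF assms] in blast)+

theorem theorem7:
  shows "(\<exists>P T\<^sub>I T\<^sub>F. convex_position P \<and> card P = 22 \<and>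
            plane_spanning_tree P T\<^sub>I \<and> plane_spanning_tree P T\<^sub>F \<and>
            (\<forall>Ts. shortest_flip_sequence P T\<^sub>I T\<^sub>F Ts \<longrightarrow> (\<exists>e\<in>T\<^sub>I. trace_length e Ts = 3))) \<and>
         (\<exists>P T\<^sub>I T\<^sub>F. convex_position P \<and> card P = 32 \<and>
            plane_spanning_tree P T\<^sub>I \<and> plane_spanning_tree P T\<^sub>F \<and>
            (\<forall>Ts. shortest_flip_sequence P T\<^sub>I T\<^sub>F Ts \<longrightarrow> (\<exists>e\<in>T\<^sub>I. trace_length e Ts = 4)))"
  using forced_trace[of 2] forced_trace[of 3] by simp

end
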